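(* Let $n\in\mathbb{N}$ and $\Omega=\mathbb{R}\times[0,1]^n\subset\mathbb{R}^{n+1}$. Let $\phi:\mathbb{R}\to\mathbb{R}$ be a measurable, essentially bounded, eventually essentially monotone function with $\lim_{x\to\infty}\phi(x)\ \text{a.e.}\neq\lim_{x\to-\infty}\phi(x)\ \text{a.e.}$ Then for every $p$ with $2\le p<\infty$, $$\overline{\mathcal{S}_{n+1}(\phi)\cap L^p(\Omega)}=L^p(\Omega),$$ where the closure is taken in $L^p(\Omega)$.
   Context: For a function $\phi:\mathbb{R}\to\mathbb{R}$ and an integer $m\ge1$, $\mathcal{S}_m(\phi)$ denotes the set of all functions on $\mathbb{R}^m$ of the form $x\mapsto\sum_{i=1}^k t_i\,\phi(\langle y_i,x\rangle+\varrho_i)$ with $k\in\mathbb{N}$, $t_i,\varrho_i\in\mathbb{R}$, $y_i\in\mathbb{R}^m$ (dot product $\langle\cdot,\cdot\rangle$). For $\Omega\subset\mathbb{R}^m$, $\mathcal{S}_m(\phi)\cap L^p(\Omega)$ denotes the set of elements of $\mathcal{S}_m(\phi)$ whose restriction to $\Omega$ lies in $L^p(\Omega)$ (Lebesgue measure, real-valued functions), identified with those restrictions. For a property $\mathcal{P}$ (such as bounded or monotone), a function $\phi:U\to\mathbb{R}$ is essentially $\mathcal{P}$ if there is a Lebesgue-null set $Z$ such that $\phi|_{U\setminus Z}$ is $\mathcal{P}$. A function $\phi:\mathbb{R}\to\mathbb{R}$ is eventually essentially $\mathcal{P}$ if there exists $X>0$ such that both $\phi|_{(X,\infty)}$ and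 $\phi|_{(-\infty,-X)}$ are essentially $\mathcal{P}$. One writes $\lim_{t\to x}\phi(t)=c$ a.e. if there is a null set $Z$ with $\lim_{t\notin Z,\,t\to x}\phi(t)=c$ (here $x$ may be $\pm\infty$). *)

theory Defs
  imports "HOL-Analysis.Analysis"
begin

definition ridge_sums :: "(real \<Rightarrow> real) \<Rightarrow> ('a::euclidean_space \<Rightarrow> real) set" where
  "ridge_sums \<phi> =
     {(\<lambda>x. \<Sum>i<k. t i * \<phi> (y i \<bullet> x + \<rho> i)) |
        (k :: nat) (t :: nat \<Rightarrow> real) (y :: nat \<Rightarrow> 'a) (\<rho> :: nat \<Rightarrow> real). True}"

text \<open>
  A property of functions takes the domain as an explicit argument, so that
  restricting \<open>\<phi>\<close> to \<open>U\<close> amounts to passing \<open>U\<close>.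
\<close>

definition bounded_fun :: "real set \<Rightarrow> (real \<Rightarrow> real) \<Rightarrow> bool" where
  "bounded_fun U \<phi> \<longleftrightarrow> bounded (\<phi> ` U)"

definition monotone_fun :: "real set \<Rightarrow> (real \<Rightarrow> real) \<Rightarrow> bool" where
  "monotone_fun U \<phi> \<longleftrightarrow> mono_on U \<phi> \<or> antimono_on U \<phi>"

definition essentially ::
    "(real set \<Rightarrow> (real \<Rightarrow> real) \<Rightarrow> bool) \<Rightarrow> real set \<Rightarrow> (real \<Rightarrow> real) \<Rightarrow> bool" where
  "essentially P U \<phi> \<longleftrightarrow> (\<exists>Z \<in> null_sets lebesgue. P (U - Z) \<phi>)"

definition eventually_essentially ::
    "(real set \<Rightarrow> (real \<Rightarrow> real) \<Rightarrow> bool) \<Rightarrow> (real \<Rightarrow> real) \<Rightarrow> bool" where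
  "eventually_essentially P \<phi> \<longleftrightarrow>
     (\<exists>X>0. essentially P {X<..} \<phi> \<and> essentially P {..<-X} \<phi>)"

text \<open>The limit along \<open>F\<close> is taken through points outside the null set only.\<close>

definition ae_tendsto :: "(real \<Rightarrow> real) \<Rightarrow> real \<Rightarrow> real filter \<Rightarrow> bool" where
  "ae_tendsto \<phi> c F \<longleftrightarrow>
     (\<exists>Z \<in> null_sets lebesgue. (\<phi> \<longlongrightarrow> c) (inf F (principal (- Z))))"

text \<open>
  Elements of \<open>L\<^sup>p(\<Omega>)\<close> are represented by functions on the whole space;
  their values outside \<open>\<Omega>\<close> are irrelevant.  No quotient by almost-everywhere
  equality is taken: \<open>Lp_norm\<close> is a seminorm on representatives, and the
  topology below is the pullback of the norm topology of the quotient.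
\<close>

definition Lp :: "real \<Rightarrow> 'a::euclidean_space set \<Rightarrow> ('a \<Rightarrow> real) set" where
  "Lp p \<Omega> = {f \<in> borel_measurable (lebesgue_on \<Omega>).
               integrable (lebesgue_on \<Omega>) (\<lambda>x. \<bar>f x\<bar> powr p)}"

definition Lp_norm :: "real \<Rightarrow> 'a::euclidean_space set \<Rightarrow> ('a \<Rightarrow> real) \<Rightarrow> real" where
  "Lp_norm p \<Omega> f = (LINT x|lebesgue_on \<Omega>. \<bar>f x\<bar> powr p) powr (1 / p)"

definition Lp_topology :: "real \<Rightarrow> 'a::euclidean_space set \<Rightarrow> ('a \<Rightarrow> real) topology" where
  "Lp_topology p \<Omega> =
     topology (\<lambda>U. U \<subseteq> Lp p \<Omega> \<and>
       (\<forall>f\<in>U. \<exists>e>0. \<forall>g\<in>Lp p \<Omega>. Lp_norm p \<Omega> (\<lambda>x. g x - f x) < e \<longrightarrow> g \<in> U))"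

lemma openin_Lp_topology:
  "openin (Lp_topology p \<Omega>) U \<longleftrightarrow>
     U \<subseteq> Lp p \<Omega> \<and>
       (\<forall>f\<in>U. \<exists>e>0. \<forall>g\<in>Lp p \<Omega>. Lp_norm p \<Omega> (\<lambda>x. g x - f x) < e \<longrightarrow> g \<in> U)"
proof -
  let ?op = "\<lambda>U. U \<subseteq> Lp p \<Omega> \<and>
       (\<forall>f\<in>U. \<exists>e>0. \<forall>g\<in>Lp p \<Omega>. Lp_norm p \<Omega> (\<lambda>x. g x - f x) < e \<longrightarrow> g \<in> U)"
  have "?op (S \<inter> T)" if S: "?op S" and T: "?op T" for S T
  proof (intro conjI ballI)
    show "S \<inter> T \<subseteq> Lp p \<Omega>" using S by blast
    fix f assume f: "f \<in> S \<inter> T"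
    obtain d where d: "d > 0"
      "\<forall>g\<in>Lp p \<Omega>. Lp_norm p \<Omega> (\<lambda>x. g x - f x) < d \<longrightarrow> g \<in> S" using S f by blast
    obtain e where e: "e > 0"
      "\<forall>g\<in>Lp p \<Omega>. Lp_norm p \<Omega> (\<lambda>x. g x - f x) < e \<longrightarrow> g \<in> T" using T f by blast
    show "\<exists>e>0. \<forall>g\<in>Lp p \<Omega>. Lp_norm p \<Omega> (\<lambda>x. g x - f x) < e \<longrightarrow> g \<in> S \<inter> T"
      using d e by (intro exI[of _ "min d e"]) auto
  qed
  moreover have "?op (\<Union>\<K>)" if K: "\<forall>S\<in>\<K>. ?op S" for \<K>
  proof (intro conjI ballI)
    show "\<Union>\<K> \<subseteq> Lp p \<Omega>" using K by blast
    fix f assume "f \<in> \<Union>\<K>"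
    then obtain S where S: "S \<in> \<K>" "f \<in> S" by blast
    then obtain e where e: "e > 0"
      "\<forall>g\<in>Lp p \<Omega>. Lp_norm p \<Omega> (\<lambda>x. g x - f x) < e \<longrightarrow> g \<in> S" using K by blast
    show "\<exists>e>0. \<forall>g\<in>Lp p \<Omega>. Lp_norm p \<Omega> (\<lambda>x. g x - f x) < e \<longrightarrow> g \<in> \<Union>\<K>"
      using e S by blast
  qed
  ultimately have "istopology ?op" unfolding istopology_def by blast
  then show ?thesis unfolding Lp_topology_def by (simp add: topology_inverse')
qed

lemma topspace_Lp_topology [simp]: "topspace (Lp_topology p \<Omega>) = Lp p \<Omega>"
proof
  show "topspace (Lp_topology p \<Omega>) \<subseteq> Lp p \<Omega>"
    unfolding topspace_def openin_Lp_topology by blast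
  have "openin (Lp_topology p \<Omega>) (Lp p \<Omega>)"
    unfolding openin_Lp_topology by (auto intro: exI[of _ 1])
  then show "Lp p \<Omega> \<subseteq> topspace (Lp_topology p \<Omega>)" by (rule openin_subset)
qed

text \<open>
  The set \<open>\<real> \<times> [0,1]\<^sup>n\<close> inside \<open>\<real>\<^sup>n\<^sup>+\<^sup>1\<close>, with coordinates indexed by a type of
  \<open>n + 1\<close> elements; the index \<open>i\<^sub>0\<close> marks the unbounded factor.
  A product of \<open>\<real>\<close> with a vector type would exclude \<open>n = 0\<close>.
\<close>

definition strip :: "'m::finite \<Rightarrow> (real ^ 'm) set" where
  "strip i\<^sub>0 = {x. \<forall>i. i \<noteq> i\<^sub>0 \<longrightarrow> x $ i \<in> {0..1}}"

end

theory Submission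
  imports Defs
begin

text \<open>
  Write points of the strip as \<open>(t, z)\<close> with \<open>t\<close> the unbounded coordinate, and let \<open>V\<close> be the closure of
  the span in question.  As \<open>k \<rightarrow> \<infinity>\<close>, the functions \<open>\<phi> (k (t - c)) - \<phi> (k (t - d))\<close> converge in
  \<open>L\<^sup>p(\<real>)\<close> to \<open>(a - b)\<close> times the indicator of \<open>(c, d]\<close>, since the monotone tails telescope.  For every
  \<open>u\<close> whose \<open>t\<close>-component is \<open>1\<close> the map \<open>x \<mapsto> u \<bullet> x\<close> pushes Lebesgue measure on the strip forward to
  Lebesgue measure on \<open>\<real>\<close>, so \<open>V\<close> contains \<open>G (u \<bullet> x)\<close> for all continuous compactly supported \<open>G\<close>.
  Differentiating \<open>q(z) g (u \<bullet> x)\<close> in the direction of \<open>u\<close> shows that \<open>V\<close> contains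
  \<open>z\<^sub>i q(z) g' (u \<bullet> x)\<close>, and for \<open>p > 1\<close> derivatives are dense in \<open>L\<^sup>p(\<real>)\<close>.  Hence \<open>V\<close> contains
  \<open>q(z) G(t)\<close> for all polynomials \<open>q\<close>, then the indicators of all boxes, and thus everything.
\<close>

text \<open>The strip has infinite measure and \<phi> has distinct limits, so a single term whose
  direction has nonzero \<open>i\<^sub>0\<close> component is never p-integrable; only combinations
  that cancel at both ends are usable. Subtracting from \<phi> a step with values a and b leaves a
  bounded remainder \<theta>, which may decay too slowly to be integrable itself. On a monotone
  tail, however, its increments over a fixed length have constant sign, so their total mass is
  controlled by one block of that length. The same obstruction returns when coordinates are
  produced: a compactly supported profile G has a compactly supported antiderivative only if its
  integral is zero. So G is first corrected by the average of R distant translates of itself. The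
  correction has height of order 1/R on a set of length of order R, hence p-th power integral of
  order R^(1-p), which vanishes in the limit for p > 1. Fixing the \<open>i\<^sub>0\<close>
  component of every direction to 1 makes all directions measure preserving at once and leaves the
  other components free to be perturbed.\<close>

lemma (in complete_measure) borel_measurable_AE:
  assumes f: "f \<in> borel_measurable M" and eq: "AE x in M. f x = g x"
  shows "g \<in> borel_measurable M"
proof (rule measurableI)
  fix A :: "'b set" assume "A \<in> sets borel"
  then have meas: "f -` A \<inter> space M \<in> sets M"
    using f by (rule measurable_sets[rotated])
  have "AE x in M. x \<in> f -` A \<inter> space M \<longleftrightarrow> x \<in> g -` A \<inter> space M"
    using eq by eventually_elim auto
  then show "g -` A \<inter> space M \<in> sets M"
    using meas by (rule in_sets_AE) simp
qed simp

text \<open>Since \<phi> is only Lebesgue measurable, its composition with a linear functional gets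
  its measurability from a Borel function equal to it almost everywhere; that transfer needs a
  complete measure.\<close>

lemma complete_measure_lebesgue_on:
  assumes "\<Omega> \<in> sets lebesgue"
  shows "complete_measure (lebesgue_on \<Omega>)"
proof
  fix A B assume "B \<subseteq> A" "A \<in> null_sets (lebesgue_on \<Omega>)"
  then have "B \<subseteq> \<Omega>" "B \<in> sets lebesgue"
    using assms completion.complete[of B A lborel] by (auto simp: null_sets_restrict_space)
  then show "B \<in> sets (lebesgue_on \<Omega>)"
    using assms by (simp add: sets_restrict_space_iff)
qed

subsection \<open>Closed subspaces of \<open>L\<^sup>p\<close>\<close>

text \<open>A crude substitute for Minkowski's inequality, from |x + y| <= 2 max(|x|, |y|). The
  factor 2^p is harmless because the bound only serves to split a tolerance.\<close>

lemma abs_add_powr_le: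
  fixes x y p :: real
  assumes "0 \<le> p"
  shows "\<bar>x + y\<bar> powr p \<le> 2 powr p * (\<bar>x\<bar> powr p + \<bar>y\<bar> powr p)"
proof -
  have "\<bar>x + y\<bar> powr p \<le> (2 * max \<bar>x\<bar> \<bar>y\<bar>) powr p"
    using assms by (intro powr_mono2) auto
  also have "\<dots> = 2 powr p * (max \<bar>x\<bar> \<bar>y\<bar>) powr p"
    by (simp add: powr_mult)
  also have "(max \<bar>x\<bar> \<bar>y\<bar>) powr p \<le> \<bar>x\<bar> powr p + \<bar>y\<bar> powr p"
    by (auto simp: max_def)
  finally show ?thesis by simp
qed

lemma Lp_measurable: "f \<in> Lp p \<Omega> \<Longrightarrow> f \<in> borel_measurable (lebesgue_on \<Omega>)"
  and Lp_integrable: "f \<in> Lp p \<Omega> \<Longrightarrow> integrable (lebesgue_on \<Omega>) (\<lambda>x. \<bar>f x\<bar> powr p)"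
  by (simp_all add: Lp_def)

lemma Lp_bounded:
  assumes "0 \<le> p" "g \<in> Lp p \<Omega>" "f \<in> borel_measurable (lebesgue_on \<Omega>)"
    and "AE x in lebesgue_on \<Omega>. \<bar>f x\<bar> \<le> \<bar>g x\<bar>"
  shows "f \<in> Lp p \<Omega>"
proof -
  have "integrable (lebesgue_on \<Omega>) (\<lambda>x. \<bar>f x\<bar> powr p)"
  proof (rule Bochner_Integration.integrable_bound[OF Lp_integrable[OF assms(2)]])
    show "AE x in lebesgue_on \<Omega>. norm (\<bar>f x\<bar> powr p) \<le> norm (\<bar>g x\<bar> powr p)"
      using assms(4) by eventually_elim (auto intro: powr_mono2 assms(1))
  qed (use assms(3) in measurable)
  then show ?thesis using assms(3) by (simp add: Lp_def)
qed

lemma Lp_add: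
  assumes p: "0 \<le> p" and f: "f \<in> Lp p \<Omega>" and g: "g \<in> Lp p \<Omega>"
  shows "(\<lambda>x. f x + g x) \<in> Lp p \<Omega>"
proof -
  note [measurable] = Lp_measurable[OF f] Lp_measurable[OF g]
  have "integrable (lebesgue_on \<Omega>) (\<lambda>x. \<bar>f x + g x\<bar> powr p)"
  proof (rule Bochner_Integration.integrable_bound)
    show "integrable (lebesgue_on \<Omega>) (\<lambda>x. 2 powr p * (\<bar>f x\<bar> powr p + \<bar>g x\<bar> powr p))"
      using Lp_integrable[OF f] Lp_integrable[OF g] by simp
    show "AE x in lebesgue_on \<Omega>. norm (\<bar>f x + g x\<bar> powr p)
        \<le> norm (2 powr p * (\<bar>f x\<bar> powr p + \<bar>g x\<bar> powr p))"
    proof (intro AE_I2)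
      fix x show "norm (\<bar>f x + g x\<bar> powr p) \<le> norm (2 powr p * (\<bar>f x\<bar> powr p + \<bar>g x\<bar> powr p))"
        using abs_add_powr_le[OF p, of "f x" "g x"] by simp
    qed
  qed measurable
  then show ?thesis unfolding Lp_def by simp
qed

lemma Lp_cmult:
  assumes "f \<in> Lp p \<Omega>"
  shows "(\<lambda>x. c * f x) \<in> Lp p \<Omega>"
  using assms unfolding Lp_def by (simp add: abs_mult powr_mult borel_measurable_times)

lemma Lp_diff:
  assumes "0 \<le> p" "f \<in> Lp p \<Omega>" "g \<in> Lp p \<Omega>"
  shows "(\<lambda>x. f x - g x) \<in> Lp p \<Omega>"
  using Lp_add[OF assms(1,2) Lp_cmult[OF assms(3), of "-1"]] by simp

lemma Lp_integral_add_le: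
  assumes p: "0 \<le> p" and f: "f \<in> Lp p \<Omega>" and g: "g \<in> Lp p \<Omega>"
  shows "(LINT x|lebesgue_on \<Omega>. \<bar>f x + g x\<bar> powr p)
    \<le> 2 powr p * ((LINT x|lebesgue_on \<Omega>. \<bar>f x\<bar> powr p) + (LINT x|lebesgue_on \<Omega>. \<bar>g x\<bar> powr p))"
proof -
  have "(LINT x|lebesgue_on \<Omega>. \<bar>f x + g x\<bar> powr p)
      \<le> (LINT x|lebesgue_on \<Omega>. 2 powr p * (\<bar>f x\<bar> powr p + \<bar>g x\<bar> powr p))"
    using Lp_integrable[OF f] Lp_integrable[OF g] Lp_integrable[OF Lp_add[OF p f g]]
    by (intro integral_mono abs_add_powr_le p) auto
  then show ?thesis
    using Lp_integrable[OF f] Lp_integrable[OF g] by simp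
qed

locale Lp_subspace =
  fixes p :: real and \<Omega> :: "'a::euclidean_space set" and W :: "('a \<Rightarrow> real) set"
  assumes p_pos: "0 < p"
    and W_subset: "W \<subseteq> Lp p \<Omega>"
    and W_add: "\<And>f g. f \<in> W \<Longrightarrow> g \<in> W \<Longrightarrow> (\<lambda>x. f x + g x) \<in> W"
    and W_cmult: "\<And>f c. f \<in> W \<Longrightarrow> (\<lambda>x. c * f x) \<in> W"
begin

abbreviation "M \<equiv> lebesgue_on \<Omega>"

lemma p_nonneg: "0 \<le> p"
  using p_pos by simp

text \<open>The closure of \<open>W\<close>, stated with the p-th power integral so that no p-th
  root occurs until it is compared with \<open>Lp_topology\<close> at the very end.\<close>

definition V :: "('a \<Rightarrow> real) set" where
  "V = {f \<in> Lp p \<Omega>. \<forall>e>0. \<exists>r\<in>W. (LINT x|M. \<bar>f x - r x\<bar> powr p) < e}"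

lemma V_Lp: "f \<in> V \<Longrightarrow> f \<in> Lp p \<Omega>"
  by (simp add: V_def)

text \<open>Closedness of \<open>V\<close>: two successive approximations are combined by the
  quasi-triangle inequality.\<close>

lemma V_approx:
  assumes f: "f \<in> Lp p \<Omega>"
    and approx: "\<And>e. e > 0 \<Longrightarrow> \<exists>g\<in>V. (LINT x|M. \<bar>f x - g x\<bar> powr p) < e"
  shows "f \<in> V"
proof -
  have "\<exists>r\<in>W. (LINT x|M. \<bar>f x - r x\<bar> powr p) < e" if "e > 0" for e
  proof -
    \<comment> \<open>Two errors below \<open>d\<close>, added and multiplied by the constant 2^p,
      stay below \<open>e\<close>.\<close>
    define d where "d = e / (2 * 2 powr p)"
    have d: "d > 0" using that by (simp add: d_def)
    obtain g where g: "g \<in> V" "(LINT x|M. \<bar>f x - g x\<bar> powr p) < d"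
      using approx[OF d] by blast
    obtain r where r: "r \<in> W" "(LINT x|M. \<bar>g x - r x\<bar> powr p) < d"
      using g(1) d by (auto simp: V_def)
    have "(LINT x|M. \<bar>(f x - g x) + (g x - r x)\<bar> powr p)
      \<le> 2 powr p * ((LINT x|M. \<bar>f x - g x\<bar> powr p) + (LINT x|M. \<bar>g x - r x\<bar> powr p))"
      using r(1) W_subset by (intro Lp_integral_add_le Lp_diff p_nonneg f g(1)[THEN V_Lp]) auto
    also have "\<dots> < 2 powr p * (d + d)"
      using g(2) r(2) by (intro mult_strict_left_mono add_strict_mono) auto
    finally show ?thesis
      using r(1) by (auto simp: d_def)
  qed
  then show ?thesis using f by (simp add: V_def)
qed

lemma V_add:
  assumes f: "f \<in> V" and g: "g \<in> V"
  shows "(\<lambda>x. f x + g x) \<in> V"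
proof -
  have "\<exists>r\<in>W. (LINT x|M. \<bar>f x + g x - r x\<bar> powr p) < e" if "e > 0" for e
  proof -
    define d where "d = e / (2 * 2 powr p)"
    have d: "d > 0" using that by (simp add: d_def)
    obtain r where r: "r \<in> W" "(LINT x|M. \<bar>f x - r x\<bar> powr p) < d"
      using f d by (auto simp: V_def)
    obtain s where s: "s \<in> W" "(LINT x|M. \<bar>g x - s x\<bar> powr p) < d"
      using g d by (auto simp: V_def)
    have "(LINT x|M. \<bar>(f x - r x) + (g x - s x)\<bar> powr p)
      \<le> 2 powr p * ((LINT x|M. \<bar>f x - r x\<bar> powr p) + (LINT x|M. \<bar>g x - s x\<bar> powr p))"
      using r(1) s(1) W_subset by (intro Lp_integral_add_le Lp_diff p_nonneg f[THEN V_Lp] g[THEN V_Lp]) auto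
    also have "\<dots> < 2 powr p * (d + d)"
      using s(2) r(2) by (intro mult_strict_left_mono add_strict_mono) auto
    finally have "(LINT x|M. \<bar>f x + g x - (r x + s x)\<bar> powr p) < e"
      by (simp add: d_def algebra_simps)
    then show ?thesis
      using W_add[OF r(1) s(1)] by (intro bexI[of _ "\<lambda>x. r x + s x"])
  qed
  then show ?thesis using Lp_add[OF p_nonneg V_Lp[OF f] V_Lp[OF g]] by (simp add: V_def)
qed

lemma V_cmult:
  assumes f: "f \<in> V"
  shows "(\<lambda>x. c * f x) \<in> V"
proof -
  have "\<exists>r\<in>W. (LINT x|M. \<bar>c * f x - r x\<bar> powr p) < e" if "e > 0" for e
  proof -
    \<comment> \<open>The summand 1 covers c = 0 and makes the final inequality strict.\<close>
    define d where "d = e / (\<bar>c\<bar> powr p + 1)"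
    have "\<bar>c\<bar> powr p + 1 > 0" by (smt (verit) powr_ge_zero)
    then have d: "d > 0" and de: "d * (\<bar>c\<bar> powr p + 1) = e"
      using that by (auto simp: d_def)
    obtain r where r: "r \<in> W" "(LINT x|M. \<bar>f x - r x\<bar> powr p) < d"
      using f d by (auto simp: V_def)
    have "(LINT x|M. \<bar>c * f x - c * r x\<bar> powr p) = (LINT x|M. \<bar>c\<bar> powr p * \<bar>f x - r x\<bar> powr p)"
      by (simp only: right_diff_distrib[symmetric] abs_mult powr_mult)
    also have "\<dots> \<le> \<bar>c\<bar> powr p * d"
      using r(2) by (simp add: mult_left_mono)
    also have "\<dots> < e"
      using d de by (simp add: algebra_simps)
    finally show ?thesis
      using W_cmult[OF r(1), of c] by (intro bexI[of _ "\<lambda>x. c * r x"])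
  qed
  then show ?thesis using Lp_cmult[OF V_Lp[OF f]] by (simp add: V_def)
qed

lemma V_diff: "f \<in> V \<Longrightarrow> g \<in> V \<Longrightarrow> (\<lambda>x. f x - g x) \<in> V"
  using V_add[of f "\<lambda>x. - 1 * g x"] V_cmult[of g "-1"] by simp

text \<open>Functions are representatives, not classes, so invariance under almost-everywhere
  equality has to be shown.\<close>

lemma V_AE:
  assumes f: "f \<in> V" and g: "g \<in> borel_measurable M" and eq: "AE x in M. f x = g x"
  shows "g \<in> V"
proof -
  have gL: "g \<in> Lp p \<Omega>"
    by (rule Lp_bounded[OF p_nonneg V_Lp[OF f] g]) (use eq in auto)
  have int0: "(LINT x|M. \<bar>g x - f x\<bar> powr p) = (LINT x|M. 0)"
    using eq Lp_measurable[OF V_Lp[OF f]] g p_pos by (intro integral_cong_AE) auto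
  show ?thesis
    by (rule V_approx[OF gL], rule bexI[OF _ f]) (simp add: int0)
qed

text \<open>Dominated convergence, the main way by which new functions enter \<open>V\<close>. Both
  g and every f k are bounded by h, so 2h dominates their differences.\<close>

lemma V_limit:
  assumes f: "\<And>k. f k \<in> V" and h: "h \<in> Lp p \<Omega>" and g: "g \<in> borel_measurable M"
    and lim: "AE x in M. (\<lambda>k. f k x) \<longlonglongrightarrow> g x"
    and bound: "\<And>k. AE x in M. \<bar>f k x\<bar> \<le> h x"
  shows "g \<in> V"
proof (rule V_approx)
  note [measurable] = Lp_measurable[OF V_Lp[OF f]] g Lp_measurable[OF h]
  have bd: "AE x in M. \<bar>g x\<bar> \<le> h x"
  proof -
    have "AE x in M. \<forall>k. \<bar>f k x\<bar> \<le> h x"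
      using bound by (simp add: AE_all_countable)
    then show ?thesis
      using lim by eventually_elim (auto intro: LIMSEQ_le_const2 tendsto_rabs)
  qed
  show "g \<in> Lp p \<Omega>"
    by (rule Lp_bounded[OF p_nonneg h g]) (use bd in auto)
  have "(\<lambda>k. LINT x|M. \<bar>g x - f k x\<bar> powr p) \<longlonglongrightarrow> (LINT x|M. 0)"
  proof (rule integral_dominated_convergence[where w = "\<lambda>x. \<bar>2 * h x\<bar> powr p"])
    show "integrable M (\<lambda>x. \<bar>2 * h x\<bar> powr p)"
      by (intro Lp_integrable Lp_cmult h)
    show "AE x in M. (\<lambda>k. \<bar>g x - f k x\<bar> powr p) \<longlonglongrightarrow> 0"
      using lim
    proof eventually_elim
      case (elim x)
      then have "(\<lambda>k. \<bar>g x - f k x\<bar>) \<longlonglongrightarrow> \<bar>g x - g x\<bar>"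
        by (intro tendsto_intros)
      then have "(\<lambda>k. \<bar>g x - f k x\<bar> powr p) \<longlonglongrightarrow> 0 powr p"
        using p_pos by (intro tendsto_powr2) auto
      then show ?case using p_pos by simp
    qed
    show "AE x in M. norm (\<bar>g x - f k x\<bar> powr p) \<le> \<bar>2 * h x\<bar> powr p" for k
      using bd bound[of k] by eventually_elim (auto intro!: powr_mono2 p_nonneg)
  qed auto
  then have "(\<lambda>k. LINT x|M. \<bar>g x - f k x\<bar> powr p) \<longlonglongrightarrow> 0" by simp
  then show "\<exists>r\<in>V. (LINT x|M. \<bar>g x - r x\<bar> powr p) < e" if "e > 0" for e
  proof -
    have "eventually (\<lambda>k. (LINT x|M. \<bar>g x - f k x\<bar> powr p) < e) sequentially"
      by (rule order_tendstoD(2)) fact+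
    then obtain k where "(LINT x|M. \<bar>g x - f k x\<bar> powr p) < e"
      by (auto simp: eventually_sequentially)
    with f show ?thesis by (intro bexI[of _ "f k"])
  qed
qed

text \<open>\<open>W\<close> is not assumed to be nonempty, so the empty sum is excluded here;
  \<open>V_sum'\<close> admits it once 0 is known to lie in \<open>V\<close>.\<close>

lemma V_sum: "finite I \<Longrightarrow> I \<noteq> {} \<Longrightarrow> (\<And>i. i \<in> I \<Longrightarrow> f i \<in> V) \<Longrightarrow> (\<lambda>x. \<Sum>i\<in>I. f i x) \<in> V"
  by (induction I rule: finite_ne_induct) (auto intro: V_add)

end

subsection \<open>Lebesgue measure on the strip\<close>

lemma closed_strip: "closed (strip i\<^sub>0)"
proof -
  have "strip i\<^sub>0 = (\<Inter>i\<in>-{i\<^sub>0}. {x. 0 \<le> x $ i} \<inter> {x. x $ i \<le> 1})"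
    by (auto simp: strip_def)
  also have "closed \<dots>"
    by (intro closed_INT ballI closed_Int closed_Collect_le continuous_intros)
  finally show ?thesis .
qed

lemma sets_strip: "strip i\<^sub>0 \<in> sets borel"
  using closed_strip by (rule borel_closed)

lemma borel_measurable_lebesgue_on:
  "f \<in> borel_measurable borel \<Longrightarrow> f \<in> borel_measurable (lebesgue_on \<Omega>)"
  by (intro measurable_restrict_space1 measurable_completion) simp

lemma strip_Basis: "strip i\<^sub>0 = {x. \<forall>b\<in>Basis - {axis i\<^sub>0 1}. x \<bullet> b \<in> {0..1}}"
proof -
  have "Basis - {axis i\<^sub>0 1} = {axis i (1::real) |i. i \<noteq> i\<^sub>0}"
    by (auto simp: Basis_vec_def axis_eq_axis)
  then show ?thesis
    by (auto simp: strip_def inner_axis)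
qed

text \<open>Fubini with the \<open>i\<^sub>0\<close> coordinate innermost: because its coefficient
  in u is 1, each section of the slab is an interval of length r - l, merely shifted by the other
  coordinates, and these range over a cube of measure 1.\<close>

lemma emeasure_strip_slab:
  fixes u :: "real ^ 'm::finite"
  assumes u: "u $ i\<^sub>0 = 1" and lr: "l \<le> r"
  shows "emeasure lborel {x \<in> strip i\<^sub>0. u \<bullet> x \<in> {l<..<r}} = ennreal (r - l)"
proof -
  interpret product_sigma_finite "\<lambda>_::real^'m. lborel :: real measure"
    by standard
  define A where "A = {x \<in> strip i\<^sub>0. u \<bullet> x \<in> {l<..<r}}"
  define e where "e = (axis i\<^sub>0 1 :: real ^ 'm)"
  define B where "B = Basis - {e}"
  have e: "e \<in> Basis" by (simp add: e_def axis_in_Basis_iff)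
  have Basis: "(Basis :: (real^'m) set) = insert e B" and B: "finite B" "e \<notin> B"
    using e by (auto simp: B_def)
  \<comment> \<open>\<open>T\<close> rebuilds a vector from its coordinates, which exhibits
    \<open>lborel\<close> as the image of a product measure over \<open>Basis\<close>.\<close>
  define T where "T = (\<lambda>f::real^'m \<Rightarrow> real. \<Sum>b\<in>insert e B. f b *\<^sub>R b)"
  have [measurable]: "strip i\<^sub>0 \<in> sets borel" by (rule sets_strip)
  have A[measurable]: "A \<in> sets borel"
    unfolding A_def by measurable
  have T[measurable]: "T \<in> borel_measurable (Pi\<^sub>M (insert e B) (\<lambda>_. lborel))"
    unfolding T_def by measurable
  define c where "c = (\<lambda>f. \<Sum>b\<in>B. f b * (u \<bullet> b))"
  have Tb: "T f \<bullet> b = f b" if "b \<in> insert e B" for f b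
    unfolding T_def using that unfolding Basis[symmetric]
    by (simp add: inner_sum_left inner_Basis if_distrib cong: if_cong)
  have Tu: "u \<bullet> T (f(e := t)) = t + c f" for f t
  proof -
    have "u \<bullet> e = 1" using u by (simp add: e_def inner_axis)
    moreover have "(\<Sum>b\<in>B. (f(e := t)) b * (u \<bullet> b)) = c f"
      unfolding c_def using B by (intro sum.cong) auto
    ultimately show ?thesis
      using B by (simp add: T_def inner_sum_right inner_add_right)
  qed
  have ind: "indicator A (T (f(e := t))) = (indicator (Pi\<^sub>E B (\<lambda>_. {0..1::real})) f * indicator {l - c f<..<r - c f} t :: ennreal)"
    if "f \<in> extensional B" for f t
  proof -
    have "(T (f(e := t)) \<in> strip i\<^sub>0) = (f \<in> Pi\<^sub>E B (\<lambda>_. {0..1::real}))"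
      using that B Tb[of _ "f(e := t)"] unfolding strip_Basis e_def[symmetric] B_def[symmetric]
      by (auto simp: PiE_def Pi_def)
    then show ?thesis
      by (auto simp: A_def Tu indicator_def)
  qed
  have "emeasure lborel A = emeasure (distr (Pi\<^sub>M (insert e B) (\<lambda>_. lborel)) borel T) A"
    unfolding T_def Basis[symmetric] by (subst lborel_eq) simp
  also have "\<dots> = (\<integral>\<^sup>+x. indicator A x \<partial>distr (Pi\<^sub>M (insert e B) (\<lambda>_. lborel)) borel T)"
    by simp
  also have "\<dots> = (\<integral>\<^sup>+f. indicator A (T f) \<partial>Pi\<^sub>M (insert e B) (\<lambda>_. lborel))"
    by (rule nn_integral_distr) measurable
  also have "\<dots> = (\<integral>\<^sup>+f. (\<integral>\<^sup>+t. indicator A (T (f(e := t))) \<partial>lborel) \<partial>Pi\<^sub>M B (\<lambda>_. lborel))"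
    by (rule product_nn_integral_insert[OF B]) measurable
  also have "\<dots> = (\<integral>\<^sup>+f. ennreal (r - l) * indicator (Pi\<^sub>E B (\<lambda>_. {0..1::real})) f \<partial>Pi\<^sub>M B (\<lambda>_. lborel))"
  proof (rule nn_integral_cong)
    fix f :: "real^'m \<Rightarrow> real" assume "f \<in> space (Pi\<^sub>M B (\<lambda>_. lborel))"
    then have f: "f \<in> extensional B" by (simp add: space_PiM PiE_def)
    show "(\<integral>\<^sup>+t. indicator A (T (f(e := t))) \<partial>lborel) = ennreal (r - l) * indicator (Pi\<^sub>E B (\<lambda>_. {0..1::real})) f"
      using lr by (simp add: ind[OF f] nn_integral_cmult mult.commute)
  qed
  also have "\<dots> = ennreal (r - l) * emeasure (Pi\<^sub>M B (\<lambda>_. lborel)) (Pi\<^sub>E B (\<lambda>_. {0..1::real}))"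
    using B by (intro nn_integral_cmult_indicator) (auto intro!: sets_PiM_I_finite)
  also have "emeasure (Pi\<^sub>M B (\<lambda>_. lborel)) (Pi\<^sub>E B (\<lambda>_. {0..1::real})) = 1"
    using B by (subst emeasure_PiM) auto
  finally show ?thesis by (simp add: A_def)
qed

text \<open>\<open>lborel\<close> is determined by its values on open intervals, and their preimages
  are the slabs just measured.\<close>

lemma distr_strip_inner:
  fixes u :: "real ^ 'm::finite"
  assumes u: "u $ i\<^sub>0 = 1"
  shows "distr (lebesgue_on (strip i\<^sub>0)) borel (\<lambda>x. u \<bullet> x) = lborel"
proof (rule lborel_eqI[symmetric])
  fix l r :: real assume "\<And>b. b \<in> Basis \<Longrightarrow> l \<bullet> b \<le> r \<bullet> b"
  then have lr: "l \<le> r" by simp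
  have [measurable]: "strip i\<^sub>0 \<in> sets borel" by (rule sets_strip)
  have slab: "{x \<in> strip i\<^sub>0. u \<bullet> x \<in> {l<..<r}} \<in> sets borel" by measurable
  have "emeasure (distr (lebesgue_on (strip i\<^sub>0)) borel (\<lambda>x. u \<bullet> x)) (box l r)
      = emeasure (lebesgue_on (strip i\<^sub>0)) {x \<in> strip i\<^sub>0. u \<bullet> x \<in> {l<..<r}}"
    by (subst emeasure_distr) (auto intro!: borel_measurable_lebesgue_on arg_cong2[where f = emeasure] simp: box_real)
  also have "\<dots> = emeasure lborel {x \<in> strip i\<^sub>0. u \<bullet> x \<in> {l<..<r}}"
    using slab sets_strip[of i\<^sub>0] by (subst emeasure_restrict_space) auto
  finally show "emeasure (distr (lebesgue_on (strip i\<^sub>0)) borel (\<lambda>x. u \<bullet> x)) (box l r) = (\<Prod>b\<in>Basis. (r - l) \<bullet> b)"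
    using emeasure_strip_slab[OF u lr] by simp
qed simp

subsection \<open>Functions on the real line\<close>

definition cont_compact_support :: "(real \<Rightarrow> real) \<Rightarrow> bool" where
  "cont_compact_support G \<longleftrightarrow> continuous_on UNIV G \<and> (\<exists>K. \<forall>t. K < \<bar>t\<bar> \<longrightarrow> G t = 0)"

lemma cont_compact_support_bound:
  assumes "cont_compact_support G"
  obtains C K where "0 \<le> C" "0 \<le> K" "\<And>t. \<bar>G t\<bar> \<le> C * indicator {-K..K} t"
proof -
  obtain K where cont: "continuous_on UNIV G" and K: "\<And>t. K < \<bar>t\<bar> \<Longrightarrow> G t = 0"
    using assms by (auto simp: cont_compact_support_def)
  have "bounded (G ` {-\<bar>K\<bar>..\<bar>K\<bar>})"
    by (intro compact_imp_bounded compact_continuous_image continuous_on_subset[OF cont]) auto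
  then obtain C where C: "\<forall>t\<in>{-\<bar>K\<bar>..\<bar>K\<bar>}. \<bar>G t\<bar> \<le> C"
    by (auto simp: bounded_iff)
  show ?thesis
  proof (rule that[of "\<bar>C\<bar>" "\<bar>K\<bar>"])
    fix t
    show "\<bar>G t\<bar> \<le> \<bar>C\<bar> * indicator {-\<bar>K\<bar>..\<bar>K\<bar>} t"
    proof (cases "t \<in> {-\<bar>K\<bar>..\<bar>K\<bar>}")
      case True
      then show ?thesis using C by fastforce
    next
      case False
      then have "K < \<bar>t\<bar>" by auto
      then show ?thesis using K[of t] by simp
    qed
  qed auto
qed

lemma cont_compact_support_measurable: "cont_compact_support G \<Longrightarrow> G \<in> borel_measurable borel"
  by (auto simp: cont_compact_support_def intro: borel_measurable_continuous_onI)

text \<open>The difference of two translates has integral zero. Its antiderivative is the integral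
  of G over the window from t - s to t, which vanishes once the window has left the support.\<close>

lemma cont_compact_support_window_antiderivative:
  assumes "cont_compact_support G" "0 < s"
  obtains g where "cont_compact_support g" "\<And>t. (g has_real_derivative G t - G (t - s)) (at t)"
proof -
  obtain K where cont: "continuous_on UNIV G" and K: "\<And>t. K < \<bar>t\<bar> \<Longrightarrow> G t = 0"
    using assms by (auto simp: cont_compact_support_def)
  have "\<And>x. isCont G x"
    using cont by (simp add: continuous_on_eq_continuous_at)
  then obtain F where "\<And>x. (F has_vector_derivative G x) (at x)"
    using einterval_antiderivative[of "-\<infinity>" "\<infinity>" G] by auto
  then have F: "(F has_real_derivative G x) (at x)" for x
    by (simp add: has_real_derivative_iff_has_vector_derivative)
  define g where "g = (\<lambda>t. F t - F (t - s))"
  have g': "(g has_real_derivative G t - G (t - s)) (at t)" for t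
  proof -
    have "((\<lambda>t. F (t - s)) has_real_derivative G (t - s) * 1) (at t)"
      by (rule DERIV_chain2[where f = F and g = "\<lambda>t. t - s", OF F]) (auto intro!: derivative_eq_intros)
    then show ?thesis
      unfolding g_def by (intro DERIV_diff F) simp
  qed
  have "continuous_on UNIV g"
    by (rule DERIV_continuous_on) (rule has_field_derivative_at_within[OF g'])
  moreover have "g t = 0" if "K + s < \<bar>t\<bar>" for t
  proof -
    \<comment> \<open>The mean value theorem replaces the window integral by a single value of G
      inside the window.\<close>
    obtain z where z: "t - s < z" "z < t" "F t - F (t - s) = (t - (t - s)) * G z"
      using MVT2[of "t - s" t F G, OF _ F] assms(2) by auto
    have "K < \<bar>z\<bar>" using z that by linarith
    then show ?thesis using z K by (simp add: g_def)
  qed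
  ultimately have "cont_compact_support g" unfolding cont_compact_support_def by blast
  then show ?thesis using that[of g] g' by blast
qed

text \<open>The displacement z may be 0, so the quotient is formed in the step h = 1/(j+1) of the
  map h -> g (t + z h), not in the displacement of the argument.\<close>

lemma difference_quotient_tendsto:
  fixes g :: "real \<Rightarrow> real"
  assumes "(g has_real_derivative d) (at t)"
  shows "(\<lambda>j. real (Suc j) * (g (t + z / real (Suc j)) - g t)) \<longlonglongrightarrow> z * d"
proof -
  have "((\<lambda>h. g (t + z * h)) has_real_derivative d * z) (at 0)"
    by (rule DERIV_chain2[where f = g and g = "\<lambda>h. t + z * h"]) (use assms in \<open>auto intro!: derivative_eq_intros\<close>)
  then have "((\<lambda>h. (g (t + z * h) - g t) / h) \<longlongrightarrow> d * z) (at 0)"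
    by (simp add: DERIV_def)
  moreover have "filterlim (\<lambda>j. 1 / real (Suc j)) (at 0) sequentially"
    using LIMSEQ_Suc[OF lim_1_over_n] by (auto simp: filterlim_at)
  ultimately have "(\<lambda>j. (g (t + z * (1 / real (Suc j))) - g t) / (1 / real (Suc j))) \<longlonglongrightarrow> d * z"
    by (rule filterlim_compose)
  then show ?thesis by (simp add: mult.commute)
qed

lemma difference_quotient_bound:
  fixes g :: "real \<Rightarrow> real"
  assumes g: "\<And>t. (g has_real_derivative d t) (at t)" and d: "\<And>t. \<bar>d t\<bar> \<le> C"
  shows "\<bar>real (Suc j) * (g (t + z / real (Suc j)) - g t)\<bar> \<le> C * \<bar>z\<bar>"
proof -
  have "\<bar>g (t + z / real (Suc j)) - g t\<bar> \<le> C * \<bar>t + z / real (Suc j) - t\<bar>"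
    using field_differentiable_bound[of UNIV g d C "t + z / real (Suc j)" t] g d by auto
  then have "real (Suc j) * \<bar>g (t + z / real (Suc j)) - g t\<bar> \<le> real (Suc j) * (C * \<bar>z\<bar> / real (Suc j))"
    by (intro mult_left_mono) (auto simp: abs_divide)
  then show ?thesis by (simp add: abs_mult)
qed

text \<open>The spacing 2K + 1 exceeds the width 2K of the supporting interval, so at most one
  summand is nonzero at any point and the bound on the height does not grow with R.\<close>

lemma disjoint_translates_sum_bound:
  fixes G :: "real \<Rightarrow> real"
  assumes C: "0 \<le> C" and K: "0 \<le> K" and G: "\<And>t. \<bar>G t\<bar> \<le> C * indicator {-K..K} t"
  shows "\<bar>\<Sum>j\<in>{1..R}. G (t - real j * (2 * K + 1))\<bar> \<le> C * indicator {-K..K + R * (2 * K + 1)} t"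
proof (cases "\<exists>j\<in>{1..R}. t - real j * (2 * K + 1) \<in> {-K..K}")
  case False
  then have "(\<Sum>j\<in>{1..R}. G (t - real j * (2 * K + 1))) = 0"
    using G by (intro sum.neutral) (metis abs_le_zero_iff indicator_simps(2) mult_zero_right)
  then show ?thesis using C by simp
next
  case True
  then obtain i where i: "i \<in> {1..R}" "t - real i * (2 * K + 1) \<in> {-K..K}" by blast
  have "G (t - real j * (2 * K + 1)) = 0" if "j \<noteq> i" for j
  proof -
    have "1 \<le> \<bar>real i - real j\<bar>" using that by linarith
    then have "2 * K + 1 \<le> \<bar>real i - real j\<bar> * (2 * K + 1)"
      using mult_right_mono[of 1 "\<bar>real i - real j\<bar>" "2 * K + 1"] K by simp
    also have "\<dots> = \<bar>(t - real j * (2 * K + 1)) - (t - real i * (2 * K + 1))\<bar>"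
    proof -
      have "(t - real j * (2 * K + 1)) - (t - real i * (2 * K + 1)) = (real i - real j) * (2 * K + 1)"
        by (simp add: algebra_simps)
      then show ?thesis using K by (simp only: abs_mult)
    qed
    finally have "t - real j * (2 * K + 1) \<notin> {-K..K}"
      using i(2) by auto
    then show ?thesis using G[of "t - real j * (2 * K + 1)"] by simp
  qed
  then have "(\<Sum>j\<in>{1..R}. G (t - real j * (2 * K + 1))) = G (t - real i * (2 * K + 1))"
    using i(1) by (subst sum.remove[of _ i]) (auto intro!: sum.neutral)
  moreover have "\<bar>G (t - real i * (2 * K + 1))\<bar> \<le> C"
    using G[of "t - real i * (2 * K + 1)"] i(2) by simp
  moreover have "t \<in> {-K..K + R * (2 * K + 1)}"
  proof -
    have "0 \<le> real i * (2 * K + 1)" "real i * (2 * K + 1) \<le> real R * (2 * K + 1)"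
      using i(1) K by (auto intro!: mult_right_mono)
    then show ?thesis using i(2) unfolding atLeastAtMost_iff by linarith
  qed
  ultimately show ?thesis by simp
qed

section \<open>Transfer of integrals and null sets between the line and the strip\<close>

lemma strip_inner_measurable: "(\<lambda>x. u \<bullet> x) \<in> borel_measurable (lebesgue_on (strip i\<^sub>0))"
  by (intro borel_measurable_lebesgue_on) simp

lemma strip_measurable_inner:
  "h \<in> borel_measurable borel \<Longrightarrow> (\<lambda>x. h (u \<bullet> x)) \<in> borel_measurable (lebesgue_on (strip i\<^sub>0))"
  using measurable_compose[OF strip_inner_measurable] .

lemma strip_integrable_inner:
  fixes h :: "real \<Rightarrow> real"
  assumes "u $ i\<^sub>0 = 1" "h \<in> borel_measurable borel"
  shows "integrable (lebesgue_on (strip i\<^sub>0)) (\<lambda>x. h (u \<bullet> x)) \<longleftrightarrow> integrable lborel h"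
  using assms(2) by (subst distr_strip_inner[OF assms(1), symmetric], subst integrable_distr_eq)
    (auto intro: strip_inner_measurable)

lemma strip_integral_inner:
  fixes h :: "real \<Rightarrow> real"
  assumes "u $ i\<^sub>0 = 1" "h \<in> borel_measurable borel"
  shows "(LINT x|lebesgue_on (strip i\<^sub>0). h (u \<bullet> x)) = (LINT t|lborel. h t)"
  using assms(2) by (subst distr_strip_inner[OF assms(1), symmetric], subst integral_distr)
    (auto intro: strip_inner_measurable)

lemma strip_AE_inner:
  assumes "u $ i\<^sub>0 = 1" "AE t in lborel. P t"
  shows "AE x in lebesgue_on (strip i\<^sub>0). P (u \<bullet> x)"
proof (rule AE_distrD[OF strip_inner_measurable])
  show "AE t in distr (lebesgue_on (strip i\<^sub>0)) borel (\<lambda>x. u \<bullet> x). P t"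
    by (subst distr_strip_inner[OF assms(1)]) (rule assms(2))
qed

lemma abs_indicator_powr:
  fixes p C :: real
  shows "0 < p \<Longrightarrow> \<bar>C * indicator A t\<bar> powr p = \<bar>C\<bar> powr p * indicator A (t::real)"
  by (simp add: indicator_def)

text \<open>Multiples of slab indicators are the standard dominating functions for
  \<open>V_limit\<close>.\<close>

lemma strip_slab_Lp:
  assumes p: "0 < p" and u: "u $ i\<^sub>0 = 1"
  shows "(\<lambda>x. C * indicator {a..b} (u \<bullet> x)) \<in> Lp p (strip i\<^sub>0)"
proof -
  have "integrable (lebesgue_on (strip i\<^sub>0)) (\<lambda>x. \<bar>C\<bar> powr p * indicator {a..b} (u \<bullet> x))"
    by (subst strip_integrable_inner[OF u])
      (auto intro!: integrable_real_indicator simp: emeasure_lborel_Icc_eq)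
  then show ?thesis
    using strip_measurable_inner[of "\<lambda>t. C * indicator {a..b} t" u i\<^sub>0] p
    unfolding Lp_def by (simp add: abs_indicator_powr)
qed

text \<open>The half-open cells have the shape supplied by the assumption \<open>interval\<close>
  below. The cell containing t has left endpoint (ceiling(n t) - 1)/n, and cells with |i| > K n are
  irrelevant since G vanishes at their left endpoints.\<close>

lemma step_approximation:
  fixes G :: "real \<Rightarrow> real"
  assumes K: "\<And>t. real K < \<bar>t\<bar> \<Longrightarrow> G t = 0" and n: "0 < n"
  shows "(\<Sum>i\<in>{- int (K * n)..int (K * n)}. G (of_int i / real n) * indicator {of_int i / real n<..of_int i / real n + 1 / real n} t)
    = G (of_int (\<lceil>real n * t\<rceil> - 1) / real n)"
proof -
  have ind: "indicator {of_int i / real n<..of_int i / real n + 1 / real n} t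
      = (if i = \<lceil>real n * t\<rceil> - 1 then 1 else 0 :: real)" for i :: int
  proof -
    have "t \<in> {of_int i / real n<..of_int i / real n + 1 / real n} \<longleftrightarrow> of_int i < real n * t \<and> real n * t \<le> of_int i + 1"
      using n by (simp add: field_simps)
    also have "\<dots> \<longleftrightarrow> i = \<lceil>real n * t\<rceil> - 1"
      by linarith
    finally show ?thesis by (simp add: indicator_def)
  qed
  have "G (of_int i / real n) = 0" if "i \<notin> {- int (K * n)..int (K * n)}" for i
  proof (rule K)
    have "int (K * n) < \<bar>i\<bar>" using that by auto
    then have "real K * real n < \<bar>of_int i\<bar>"
      by (metis of_int_abs of_int_less_iff of_int_of_nat_eq of_nat_mult)
    then show "real K < \<bar>of_int i / real n\<bar>"
      using n by (simp add: abs_divide less_divide_eq)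
  qed
  from this[of "\<lceil>real n * t\<rceil> - 1"] show ?thesis
    unfolding ind by (cases "\<lceil>real n * t\<rceil> - 1 \<in> {- int (K * n)..int (K * n)}")
      (simp_all add: if_distrib sum.delta' del: atLeastAtMost_iff cong: if_cong)
qed

lemma ceiling_approximation_bound:
  assumes "0 < n"
  shows "\<bar>of_int (\<lceil>real n * t\<rceil> - 1) / real n - t\<bar> \<le> 1 / real n"
proof -
  have "\<bar>of_int (\<lceil>real n * t\<rceil> - 1) - real n * t\<bar> \<le> 1" by linarith
  then have "\<bar>of_int (\<lceil>real n * t\<rceil> - 1) - real n * t\<bar> / real n \<le> 1 / real n"
    by (rule divide_right_mono) simp
  also have "\<bar>of_int (\<lceil>real n * t\<rceil> - 1) - real n * t\<bar> / real n = \<bar>of_int (\<lceil>real n * t\<rceil> - 1) / real n - t\<bar>"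
  proof -
    have "of_int (\<lceil>real n * t\<rceil> - 1) / real n - t = (of_int (\<lceil>real n * t\<rceil> - 1) - real n * t) / real n"
      using assms by (simp add: field_simps)
    then show ?thesis by (simp only: abs_divide abs_of_nat)
  qed
  finally show ?thesis .
qed

subsection \<open>Density of ridge functions with arbitrary profiles\<close>

text \<open>The assumption \<open>interval\<close> is all that is retained of \<phi>; everything
  proved in this locale is independent of the activation function.\<close>

locale strip_subspace = Lp_subspace p "strip i\<^sub>0" W
  for p :: real and i\<^sub>0 :: "'m::finite" and W :: "(real ^ 'm \<Rightarrow> real) set" +
  assumes p_gt_1: "1 < p"
    and interval: "\<And>c d u. c < d \<Longrightarrow> u $ i\<^sub>0 = 1 \<Longrightarrow> (\<lambda>x. indicator {c<..d} (u \<bullet> x)) \<in> V"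
begin

lemmas measurable_comp_inner = strip_measurable_inner[of _ _ i\<^sub>0]
lemmas slab_Lp = strip_slab_Lp[OF p_pos, of _ i\<^sub>0]

lemma ridge:
  assumes G: "cont_compact_support G" and u: "u $ i\<^sub>0 = 1"
  shows "(\<lambda>x. G (u \<bullet> x)) \<in> V"
proof -
  obtain C K\<^sub>0 where C: "0 \<le> C" and K\<^sub>0: "\<And>t. \<bar>G t\<bar> \<le> C * indicator {-K\<^sub>0..K\<^sub>0} t"
    using cont_compact_support_bound[OF G] by metis
  obtain K :: nat where K: "K\<^sub>0 \<le> real K" using real_arch_simple by blast
  have G0: "G t = 0" if "real K < \<bar>t\<bar>" for t
  proof -
    have "t \<notin> {-K\<^sub>0..K\<^sub>0}" using that K by auto
    then show ?thesis using K\<^sub>0[of t] by simp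
  qed
  have GC: "\<bar>G t\<bar> \<le> C" for t
    using C K\<^sub>0[of t] by (cases "t \<in> {-K\<^sub>0..K\<^sub>0}") (auto simp: indicator_def)
  define T where "T = (\<lambda>j t. of_int (\<lceil>real (Suc j) * t\<rceil> - 1) / real (Suc j))"
  have T: "\<bar>T j t - t\<bar> \<le> 1 / real (Suc j)" for j t
    unfolding T_def by (rule ceiling_approximation_bound) simp
  show ?thesis
  proof (rule V_limit)
    let ?I = "\<lambda>j. {- int (K * Suc j)..int (K * Suc j)}"
    have "(\<lambda>x. \<Sum>i\<in>?I j. G (of_int i / real (Suc j)) *
        indicator {of_int i / real (Suc j)<..of_int i / real (Suc j) + 1 / real (Suc j)} (u \<bullet> x)) \<in> V" for j
      by (intro V_sum V_cmult interval u) auto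
    then show "(\<lambda>x. G (T j (u \<bullet> x))) \<in> V" for j
      by (subst (asm) step_approximation[OF G0]) (simp_all add: T_def)
    \<comment> \<open>The sample point \<open>T j t\<close> can be up to 1 away from t, hence the
      radius K + 1 in place of K.\<close>
    show "(\<lambda>x. C * indicator {-(real K + 1)..real K + 1} (u \<bullet> x)) \<in> Lp p (strip i\<^sub>0)"
      by (rule slab_Lp[OF u])
    show "(\<lambda>x. G (u \<bullet> x)) \<in> borel_measurable M"
      by (rule measurable_comp_inner[OF cont_compact_support_measurable[OF G]])
    show "AE x in M. (\<lambda>j. G (T j (u \<bullet> x))) \<longlonglongrightarrow> G (u \<bullet> x)"
    proof (intro AE_I2)
      fix x
      have "(\<lambda>j. T j (u \<bullet> x) - u \<bullet> x) \<longlonglongrightarrow> 0"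
      proof (rule Lim_null_comparison)
        show "(\<lambda>j. 1 / real (Suc j)) \<longlonglongrightarrow> 0"
          by (rule LIMSEQ_Suc[OF lim_1_over_n])
        show "\<forall>\<^sub>F j in sequentially. norm (T j (u \<bullet> x) - u \<bullet> x) \<le> 1 / real (Suc j)"
          using T by (intro always_eventually allI) simp
      qed
      then have "(\<lambda>j. T j (u \<bullet> x)) \<longlonglongrightarrow> u \<bullet> x"
        by (simp add: LIM_zero_iff)
      moreover have "isCont G (u \<bullet> x)"
        using G by (simp add: cont_compact_support_def continuous_on_eq_continuous_at)
      ultimately show "(\<lambda>j. G (T j (u \<bullet> x))) \<longlonglongrightarrow> G (u \<bullet> x)"
        by (rule isCont_tendsto_compose[rotated])
    qed
    show "AE x in M. \<bar>G (T j (u \<bullet> x))\<bar> \<le> C * indicator {-(real K + 1)..real K + 1} (u \<bullet> x)" for j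
    proof (intro AE_I2)
      fix x
      show "\<bar>G (T j (u \<bullet> x))\<bar> \<le> C * indicator {-(real K + 1)..real K + 1} (u \<bullet> x)"
      proof (cases "u \<bullet> x \<in> {-(real K + 1)..real K + 1}")
        case True
        then show ?thesis using GC by simp
      next
        case False
        have "1 / real (Suc j) \<le> 1" by simp
        then have "\<bar>T j (u \<bullet> x) - u \<bullet> x\<bar> \<le> 1" using T[of j "u \<bullet> x"] by linarith
        then have "real K < \<bar>T j (u \<bullet> x)\<bar>" using False unfolding atLeastAtMost_iff by linarith
        then show ?thesis using G0 False by simp
      qed
    qed
  qed
qed

text \<open>All directions u are quantified over because gaining a coordinate requires perturbing u.
  Boundedness on the strip supplies the dominating functions when limits of multipliers are
  taken.\<close>

definition multiplier :: "(real ^ 'm \<Rightarrow> real) \<Rightarrow> bool" where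
  "multiplier q \<longleftrightarrow> q \<in> borel_measurable M \<and> (\<exists>B. \<forall>x\<in>strip i\<^sub>0. \<bar>q x\<bar> \<le> B) \<and>
     (\<forall>G u. cont_compact_support G \<longrightarrow> u $ i\<^sub>0 = 1 \<longrightarrow> (\<lambda>x. q x * G (u \<bullet> x)) \<in> V)"

lemma multiplier_measurable: "multiplier q \<Longrightarrow> q \<in> borel_measurable M"
  and multiplier_V: "multiplier q \<Longrightarrow> cont_compact_support G \<Longrightarrow> u $ i\<^sub>0 = 1 \<Longrightarrow> (\<lambda>x. q x * G (u \<bullet> x)) \<in> V"
  by (auto simp: multiplier_def)

lemma multiplier_bound:
  assumes "multiplier q"
  obtains B where "0 \<le> B" "\<And>x. x \<in> strip i\<^sub>0 \<Longrightarrow> \<bar>q x\<bar> \<le> B"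
proof -
  obtain B where "\<forall>x\<in>strip i\<^sub>0. \<bar>q x\<bar> \<le> B"
    using assms by (auto simp: multiplier_def)
  then have "\<bar>q x\<bar> \<le> \<bar>B\<bar>" if "x \<in> strip i\<^sub>0" for x
    using that by fastforce
  then show ?thesis using that[of "\<bar>B\<bar>"] by simp
qed

lemma multiplier_one: "multiplier (\<lambda>x. 1)"
  by (auto simp: multiplier_def intro: ridge exI[of _ 1])

lemma multiplier_add:
  assumes q: "multiplier q" and r: "multiplier r"
  shows "multiplier (\<lambda>x. q x + r x)"
proof -
  obtain B B' where "\<And>x. x \<in> strip i\<^sub>0 \<Longrightarrow> \<bar>q x\<bar> \<le> B" "\<And>x. x \<in> strip i\<^sub>0 \<Longrightarrow> \<bar>r x\<bar> \<le> B'"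
    using multiplier_bound[OF q] multiplier_bound[OF r] by metis
  then have "\<forall>x\<in>strip i\<^sub>0. \<bar>q x + r x\<bar> \<le> B + B'"
    by (meson abs_triangle_ineq add_mono order_trans)
  then show ?thesis
    using multiplier_measurable[OF q] multiplier_measurable[OF r] V_add[OF multiplier_V[OF q] multiplier_V[OF r]]
    unfolding multiplier_def distrib_right by (auto intro: borel_measurable_add)
qed

lemma multiplier_cmult:
  assumes q: "multiplier q"
  shows "multiplier (\<lambda>x. c * q x)"
proof -
  obtain B where B: "\<And>x. x \<in> strip i\<^sub>0 \<Longrightarrow> \<bar>q x\<bar> \<le> B"
    using multiplier_bound[OF q] by metis
  have "\<forall>x\<in>strip i\<^sub>0. \<bar>c * q x\<bar> \<le> \<bar>c\<bar> * B"
    using B by (simp add: abs_mult mult_left_mono)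
  then show ?thesis
    using multiplier_measurable[OF q] V_cmult[OF multiplier_V[OF q]]
    unfolding multiplier_def mult.assoc by (auto intro: borel_measurable_times)
qed

lemma multiplier_limit:
  assumes q: "\<And>j. multiplier (q j)" and B: "\<And>j x. x \<in> strip i\<^sub>0 \<Longrightarrow> \<bar>q j x\<bar> \<le> B"
    and lim: "\<And>x. x \<in> strip i\<^sub>0 \<Longrightarrow> (\<lambda>j. q j x) \<longlonglongrightarrow> r x"
  shows "multiplier r"
proof -
  have r: "r \<in> borel_measurable M"
    by (rule borel_measurable_LIMSEQ_real[OF _ multiplier_measurable[OF q]]) (use lim in simp)
  have "\<forall>x\<in>strip i\<^sub>0. \<bar>r x\<bar> \<le> B"
    using B by (intro ballI LIMSEQ_le_const2[OF tendsto_rabs[OF lim]]) auto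
  moreover have "(\<lambda>x. r x * G (u \<bullet> x)) \<in> V" if G: "cont_compact_support G" and u: "u $ i\<^sub>0 = 1" for G u
  proof -
    obtain C K where C: "0 \<le> C" and K: "\<And>t. \<bar>G t\<bar> \<le> C * indicator {-K..K} t"
      using cont_compact_support_bound[OF G] by metis
    show ?thesis
    proof (rule V_limit[OF multiplier_V[OF q G u]])
      show "(\<lambda>x. (\<bar>B\<bar> * C) * indicator {-K..K} (u \<bullet> x)) \<in> Lp p (strip i\<^sub>0)"
        by (rule slab_Lp[OF u])
      show "(\<lambda>x. r x * G (u \<bullet> x)) \<in> borel_measurable M"
        using r measurable_comp_inner[OF cont_compact_support_measurable[OF G]] by (rule borel_measurable_times)
      show "AE x in M. (\<lambda>j. q j x * G (u \<bullet> x)) \<longlonglongrightarrow> r x * G (u \<bullet> x)"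
        by (intro AE_I2 tendsto_intros lim) simp
      show "AE x in M. \<bar>q j x * G (u \<bullet> x)\<bar> \<le> (\<bar>B\<bar> * C) * indicator {-K..K} (u \<bullet> x)" for j
      proof (intro AE_I2)
        fix x assume "x \<in> space M"
        then have "\<bar>q j x\<bar> \<le> \<bar>B\<bar>" using B[of x j] by simp
        then show "\<bar>q j x * G (u \<bullet> x)\<bar> \<le> (\<bar>B\<bar> * C) * indicator {-K..K} (u \<bullet> x)"
          unfolding abs_mult mult.assoc by (intro mult_mono K) auto
      qed
    qed
  qed
  ultimately show ?thesis using r by (auto simp: multiplier_def)
qed

text \<open>
  Differentiating a ridge function with respect to its direction multiplies it by a coordinate;
  the price is a derivative on the profile.
\<close>
lemma multiplier_coordinate_window:
  assumes q: "multiplier q" and i: "i \<noteq> i\<^sub>0" and G: "cont_compact_support G" and u: "u $ i\<^sub>0 = 1" and s: "0 < s"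
  shows "(\<lambda>x. x $ i * q x * (G (u \<bullet> x) - G (u \<bullet> x - s))) \<in> V"
proof -
  obtain g where g: "cont_compact_support g" and g': "\<And>t. (g has_real_derivative G t - G (t - s)) (at t)"
    using cont_compact_support_window_antiderivative[OF G s] by blast
  obtain B where B: "0 \<le> B" "\<And>x. x \<in> strip i\<^sub>0 \<Longrightarrow> \<bar>q x\<bar> \<le> B"
    using multiplier_bound[OF q] by metis
  obtain C\<^sub>0 K\<^sub>0 where C\<^sub>0: "0 \<le> C\<^sub>0" "\<And>t. \<bar>G t\<bar> \<le> C\<^sub>0 * indicator {-K\<^sub>0..K\<^sub>0} t"
    using cont_compact_support_bound[OF G] by metis
  obtain C\<^sub>1 K where K: "0 \<le> K" "\<And>t. \<bar>g t\<bar> \<le> C\<^sub>1 * indicator {-K..K} t"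
    using cont_compact_support_bound[OF g] by metis
  define C where "C = 2 * C\<^sub>0"
  have C: "\<bar>G t - G (t - s)\<bar> \<le> C" for t
  proof -
    have "\<bar>G t\<bar> \<le> C\<^sub>0" for t
      using C\<^sub>0(1) C\<^sub>0(2)[of t] by (cases "t \<in> {-K\<^sub>0..K\<^sub>0}") (auto simp: indicator_def)
    from this[of t] this[of "t - s"] show ?thesis by (simp add: C_def)
  qed
  have zero: "g t = 0" if "t \<notin> {-K..K}" for t
    using K(2)[of t] that by simp
  \<comment> \<open>Only a bounded coordinate of the direction is moved, so \<open>v j\<close>
    remains admissible and the scaled difference \<open>f j\<close> below lies in
    \<open>V\<close>.\<close>
  define v where "v = (\<lambda>j. u + (1 / real (Suc j)) *\<^sub>R axis i 1)"
  have v: "v j $ i\<^sub>0 = 1" for j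
    using u i by (simp add: v_def axis_def)
  have v_inner: "v j \<bullet> x = u \<bullet> x + x $ i / real (Suc j)" for j x
    by (simp add: v_def inner_add_left inner_axis inner_commute[of "axis i 1"])
  define f where "f = (\<lambda>j x. real (Suc j) * (q x * g (v j \<bullet> x) - q x * g (u \<bullet> x)))"
  have f_eq: "f j x = q x * (real (Suc j) * (g (u \<bullet> x + x $ i / real (Suc j)) - g (u \<bullet> x)))" for j x
    by (simp only: f_def v_inner) (simp add: algebra_simps)
  have fV: "f j \<in> V" for j
    unfolding f_def by (intro V_cmult V_diff multiplier_V q g u v)
  show ?thesis
  proof (rule V_limit[OF fV])
    \<comment> \<open>The coordinate \<open>x $ i\<close> lies in [0,1] on the strip, so changing
      the direction shifts the argument of g by at most 1: one slab contains the supports of all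
      \<open>f j\<close>, whatever j.\<close>
    show "(\<lambda>x. (B * C) * indicator {-(K+1)..K+1} (u \<bullet> x)) \<in> Lp p (strip i\<^sub>0)"
      by (rule slab_Lp[OF u])
    have [measurable]: "(\<lambda>x. G (u \<bullet> x)) \<in> borel_measurable M" "(\<lambda>x. G (u \<bullet> x - s)) \<in> borel_measurable M"
      using measurable_comp_inner[of G u] measurable_comp_inner[of "\<lambda>t. G (t - s)" u]
        cont_compact_support_measurable[OF G] by auto
    have [measurable]: "q \<in> borel_measurable M" by (rule multiplier_measurable[OF q])
    have [measurable]: "(\<lambda>x. x $ i) \<in> borel_measurable M"
      by (intro borel_measurable_lebesgue_on) simp
    show "(\<lambda>x. x $ i * q x * (G (u \<bullet> x) - G (u \<bullet> x - s))) \<in> borel_measurable M"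
      by measurable
    show "AE x in M. (\<lambda>j. f j x) \<longlonglongrightarrow> x $ i * q x * (G (u \<bullet> x) - G (u \<bullet> x - s))"
    proof (intro AE_I2)
      fix x
      have "(\<lambda>j. f j x) \<longlonglongrightarrow> q x * (x $ i * (G (u \<bullet> x) - G (u \<bullet> x - s)))"
        unfolding f_eq by (intro tendsto_mult_left difference_quotient_tendsto g')
      then show "(\<lambda>j. f j x) \<longlonglongrightarrow> x $ i * q x * (G (u \<bullet> x) - G (u \<bullet> x - s))"
        by (simp add: mult_ac)
    qed
    show "AE x in M. \<bar>f j x\<bar> \<le> (B * C) * indicator {-(K+1)..K+1} (u \<bullet> x)" for j
    proof (intro AE_I2)
      fix x assume "x \<in> space M"
      then have x: "x \<in> strip i\<^sub>0" by simp
      then have xi: "0 \<le> x $ i" "x $ i \<le> 1" using i by (auto simp: strip_def)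
      show "\<bar>f j x\<bar> \<le> (B * C) * indicator {-(K+1)..K+1} (u \<bullet> x)"
      proof (cases "u \<bullet> x \<in> {-(K+1)..K+1}")
        case True
        have "\<bar>real (Suc j) * (g (u \<bullet> x + x $ i / real (Suc j)) - g (u \<bullet> x))\<bar> \<le> C * \<bar>x $ i\<bar>"
          by (rule difference_quotient_bound[OF g' C])
        also have "\<dots> \<le> C * 1"
          using xi C\<^sub>0(1) by (intro mult_left_mono) (auto simp: C_def)
        finally have "\<bar>f j x\<bar> \<le> B * C"
          unfolding f_eq abs_mult[of "q x"] using B x by (intro mult_mono) auto
        then show ?thesis using True by simp
      next
        case False
        have "0 \<le> x $ i / real (Suc j)" "x $ i / real (Suc j) \<le> 1"
          using xi by (auto simp: divide_le_eq)
        then have "u \<bullet> x \<notin> {-K..K}" "u \<bullet> x + x $ i / real (Suc j) \<notin> {-K..K}"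
          using False unfolding atLeastAtMost_iff by linarith+
        then have "f j x = 0"
          unfolding f_eq using zero by simp
        then show ?thesis using False by simp
      qed
    qed
  qed
qed

text \<open>
  Averaging over \<open>R\<close> disjoint translates of the profile leaves an error of size \<open>R powr (1 - p)\<close>;
  this is where \<open>1 < p\<close> enters.
\<close>
lemma multiplier_coordinate:
  assumes q: "multiplier q" and i: "i \<noteq> i\<^sub>0"
  shows "multiplier (\<lambda>x. x $ i * q x)"
proof -
  obtain B where B: "0 \<le> B" "\<And>x. x \<in> strip i\<^sub>0 \<Longrightarrow> \<bar>q x\<bar> \<le> B"
    using multiplier_bound[OF q] by metis
  have xq: "\<bar>x $ i * q x\<bar> \<le> B" if "x \<in> strip i\<^sub>0" for x
  proof -
    have "\<bar>x $ i\<bar> \<le> 1" using that i by (auto simp: strip_def)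
    then show ?thesis
      using mult_mono[of "\<bar>x $ i\<bar>" 1 "\<bar>q x\<bar>" B] B that by (simp add: abs_mult)
  qed
  have [measurable]: "q \<in> borel_measurable M" by (rule multiplier_measurable[OF q])
  have [measurable]: "(\<lambda>x. x $ i) \<in> borel_measurable M"
    by (intro borel_measurable_lebesgue_on) simp
  have "(\<lambda>x. x $ i * q x * G (u \<bullet> x)) \<in> V" if G: "cont_compact_support G" and u: "u $ i\<^sub>0 = 1" for G u
  proof (rule V_approx)
    obtain C K where C: "0 \<le> C" and K: "0 \<le> K" and CK: "\<And>t. \<bar>G t\<bar> \<le> C * indicator {-K..K} t"
      using cont_compact_support_bound[OF G] by metis
    define L where "L = 2 * K + 1"
    have L: "0 < L" using K by (simp add: L_def)
    have [measurable]: "(\<lambda>x. G (u \<bullet> x)) \<in> borel_measurable M"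
      by (rule measurable_comp_inner[OF cont_compact_support_measurable[OF G]])
    show "(\<lambda>x. x $ i * q x * G (u \<bullet> x)) \<in> Lp p (strip i\<^sub>0)"
    proof (rule Lp_bounded[OF p_nonneg slab_Lp[OF u]])
      show "AE x in M. \<bar>x $ i * q x * G (u \<bullet> x)\<bar> \<le> \<bar>(B * C) * indicator {-K..K} (u \<bullet> x)\<bar>"
      proof (intro AE_I2)
        fix x assume "x \<in> space M"
        then have "\<bar>x $ i * q x * G (u \<bullet> x)\<bar> \<le> B * (C * indicator {-K..K} (u \<bullet> x))"
          unfolding abs_mult[of _ "G (u \<bullet> x)"] using xq[of x] B(1) by (intro mult_mono CK) auto
        then show "\<bar>x $ i * q x * G (u \<bullet> x)\<bar> \<le> \<bar>(B * C) * indicator {-K..K} (u \<bullet> x)\<bar>"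
          by (simp add: mult.assoc)
      qed
    qed measurable
    \<comment> \<open>Each summand is in \<open>V\<close> by the window lemma with s = j L. In
      \<open>A R x / R\<close> the term with G itself appears with weight 1, so the approximation
      error is just the average of the R translates.\<close>
    define A where "A = (\<lambda>R x. \<Sum>j\<in>{1..R}. x $ i * q x * (G (u \<bullet> x) - G (u \<bullet> x - real j * L)))"
    \<comment> \<open>Height B C / R to the power p, times the length of the interval that carries
      all the translates.\<close>
    define E where "E = (\<lambda>R::nat. (B * C / real R) powr p * (2 * K + real R * L))"
    have AV: "(\<lambda>x. (1 / real R) * A R x) \<in> V" if "R > 0" for R
      unfolding A_def using that L
      by (intro V_cmult V_sum multiplier_coordinate_window q i G u) auto
    have est: "(LINT x|M. \<bar>x $ i * q x * G (u \<bullet> x) - (1 / real R) * A R x\<bar> powr p) \<le> E R" if R: "R > 0" for R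
    proof -
      have eq: "x $ i * q x * G (u \<bullet> x) - (1 / real R) * A R x
          = x $ i * q x * ((\<Sum>j\<in>{1..R}. G (u \<bullet> x - real j * L)) / real R)" for x
        using R by (simp add: A_def sum_distrib_left[symmetric] sum_subtractf field_simps)
      have "(LINT x|M. \<bar>x $ i * q x * G (u \<bullet> x) - (1 / real R) * A R x\<bar> powr p)
          \<le> (LINT x|M. \<bar>(B * C / real R) * indicator {-K..K + R * L} (u \<bullet> x)\<bar> powr p)"
      proof (rule integral_mono')
        show "integrable M (\<lambda>x. \<bar>(B * C / real R) * indicator {-K..K + R * L} (u \<bullet> x)\<bar> powr p)"
          by (intro Lp_integrable slab_Lp u)
        fix x assume "x \<in> space M"
        then have "\<bar>x $ i * q x * ((\<Sum>j\<in>{1..R}. G (u \<bullet> x - real j * L)) / real R)\<bar>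
            \<le> B * ((C * indicator {-K..K + R * L} (u \<bullet> x)) / real R)"
          unfolding abs_mult[of _ "_ / _"] abs_divide abs_of_nat L_def using xq[of x] B(1) C
          by (intro mult_mono divide_right_mono disjoint_translates_sum_bound[OF C K CK]) auto
        then have "\<bar>x $ i * q x * ((\<Sum>j\<in>{1..R}. G (u \<bullet> x - real j * L)) / real R)\<bar>
            \<le> \<bar>(B * C / real R) * indicator {-K..K + R * L} (u \<bullet> x)\<bar>"
          using B(1) C by (simp add: abs_mult)
        then show "\<bar>x $ i * q x * G (u \<bullet> x) - (1 / real R) * A R x\<bar> powr p
            \<le> \<bar>(B * C / real R) * indicator {-K..K + R * L} (u \<bullet> x)\<bar> powr p"
          unfolding eq by (intro powr_mono2 p_nonneg) auto
      qed simp
      also have "\<dots> = (LINT t|lborel. (B * C / real R) powr p * indicator {-K..K + R * L} t)"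
        unfolding abs_indicator_powr[OF p_pos] using B(1) C by (subst strip_integral_inner[OF u]) auto
      also have "\<dots> = E R"
        using K L by (simp add: E_def)
      finally show ?thesis .
    qed
    have "E \<longlonglongrightarrow> 0"
    proof -
      have "(\<lambda>R. (B * C) powr p * (2 * K * real R powr (- p) + L * real R powr (1 - p)))
          \<longlonglongrightarrow> (B * C) powr p * (2 * K * 0 + L * 0)"
        using p_gt_1 by (intro tendsto_intros tendsto_neg_powr filterlim_real_sequentially) auto
      moreover have "eventually (\<lambda>R. (B * C) powr p * (2 * K * real R powr (- p) + L * real R powr (1 - p)) = E R) sequentially"
        using eventually_gt_at_top[of 0]
        by eventually_elim (simp add: E_def powr_divide powr_diff powr_minus field_simps)
      ultimately show ?thesis
        using Lim_transform_eventually by fastforce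
    qed
    fix e :: real assume "0 < e"
    then have "eventually (\<lambda>R. E R < e \<and> R > 0) sequentially"
      using \<open>E \<longlonglongrightarrow> 0\<close> by (intro eventually_conj order_tendstoD eventually_gt_at_top)
    then obtain R where R: "E R < e" "R > 0"
      by (auto simp: eventually_sequentially)
    show "\<exists>g\<in>V. (LINT x|M. \<bar>x $ i * q x * G (u \<bullet> x) - g x\<bar> powr p) < e"
      using est[OF R(2)] R(1) by (intro bexI[OF _ AV[OF R(2)]]) simp
  qed
  then show ?thesis
    using xq unfolding multiplier_def by auto
qed

end

text \<open>Closedness makes the distance positive off C, so steeper tents eventually vanish there.
  Nonemptiness matters because \<open>infdist y {}\<close> is 0, which would make every tent
  constantly 1.\<close>

lemma infdist_tent_tendsto:
  fixes y :: "'a::metric_space"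
  assumes "closed C" "C \<noteq> {}"
  shows "(\<lambda>k. max 0 (1 - real (Suc k) * infdist y C)) \<longlonglongrightarrow> indicator C y"
proof (cases "y \<in> C")
  case False
  then have pos: "infdist y C > 0"
    using assms by (simp add: infdist_pos_not_in_closed)
  obtain N :: nat where N: "1 / infdist y C < real N"
    using reals_Archimedean2 by blast
  have "max 0 (1 - real (Suc k) * infdist y C) = 0" if "k \<ge> N" for k
  proof -
    have "1 / infdist y C < real (Suc k)" using N that by linarith
    then show ?thesis using pos by (simp add: divide_less_eq)
  qed
  then have "eventually (\<lambda>k. max 0 (1 - real (Suc k) * infdist y C) = 0) sequentially"
    by (auto simp: eventually_sequentially)
  then show ?thesis using False by (simp add: tendsto_eventually)
qed simp

lemma infdist_tent_range: "max 0 (1 - real (Suc k) * infdist y C) \<in> {0..1}"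
  using infdist_nonneg[of y C] by auto

section \<open>Multipliers depending only on the bounded coordinates\<close>

context strip_subspace
begin

lemma V_zero: "(\<lambda>x. 0) \<in> V"
  using ridge[of "\<lambda>t. 0" "axis i\<^sub>0 1"] by (simp add: cont_compact_support_def)

lemma V_indicator_empty: "indicator {} \<in> V"
  using V_zero by (simp add: indicator_def[abs_def])

lemma V_sum': "finite I \<Longrightarrow> (\<And>i. i \<in> I \<Longrightarrow> f i \<in> V) \<Longrightarrow> (\<lambda>x. \<Sum>i\<in>I. f i x) \<in> V"
  using V_sum[of I f] V_zero by (cases "I = {}") auto

lemma multiplier_sum:
  assumes "finite I" "\<And>i. i \<in> I \<Longrightarrow> multiplier (f i)"
  shows "multiplier (\<lambda>x. \<Sum>i\<in>I. f i x)"
  using assms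
proof (induction I)
  case empty
  then show ?case using multiplier_cmult[OF multiplier_one, of 0] by simp
qed (auto intro: multiplier_add)

text \<open>Setting the unbounded coordinate to 0 instead of deleting it avoids a second index type,
  and the strip is still mapped into a compact cube, as Stone-Weierstrass requires.\<close>

definition proj :: "real ^ 'm \<Rightarrow> real ^ 'm" where
  "proj x = (\<chi> i. if i = i\<^sub>0 then 0 else x $ i)"

lemma proj_expansion: "proj x = (\<Sum>i\<in>-{i\<^sub>0}. x $ i *\<^sub>R axis i 1)"
  by (simp add: proj_def vec_eq_iff axis_def if_distrib sum.delta' cong: if_cong)

lemma proj_strip: "x \<in> strip i\<^sub>0 \<Longrightarrow> proj x \<in> cbox 0 (\<chi> i. 1)"
  by (auto simp: strip_def proj_def mem_box_cart)

text \<open>The extra factor q is what makes the induction work: for a product f g, the hypothesis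
  for f is applied to the multiplier obtained from g and q. Linear maps reduce to
  coordinates.\<close>

lemma multiplier_polynomial:
  assumes "real_polynomial_function f" "multiplier q"
  shows "multiplier (\<lambda>x. f (proj x) * q x)"
  using assms
proof (induction arbitrary: q rule: real_polynomial_function.induct)
  case (linear f)
  then have "f (proj x) * q x = (\<Sum>i\<in>-{i\<^sub>0}. f (axis i 1) * (x $ i * q x))" for x
    unfolding proj_expansion bounded_linear.linear[THEN linear_sum]
    by (simp add: linear_sum bounded_linear.linear linear_cmul sum_distrib_right mult_ac)
  then show ?case
    using linear by (auto intro!: multiplier_sum multiplier_cmult multiplier_coordinate)
next
  case (const c)
  then show ?case by (rule multiplier_cmult)
next
  case (add f g)
  then show ?case by (simp add: distrib_right multiplier_add)
next
  case (mult f g)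
  then show ?case by (simp add: mult.assoc)
qed

lemma multiplier_continuous:
  assumes F: "continuous_on UNIV F"
  shows "multiplier (\<lambda>x. F (proj x))"
proof -
  define Q where "Q = cbox 0 (\<chi> i. 1 :: real ^ 'm)"
  have "compact Q" by (simp add: Q_def)
  have FQ: "continuous_on Q F" by (rule continuous_on_subset[OF F]) simp
  have "\<exists>g. real_polynomial_function g \<and> (\<forall>x\<in>Q. \<bar>F x - g x\<bar> < 1 / real (Suc j))" for j
    using Stone_Weierstrass_real_polynomial_function[OF \<open>compact Q\<close> FQ, of "1 / real (Suc j)"]
    by (metis of_nat_0_less_iff zero_less_Suc zero_less_divide_1_iff)
  then obtain g where g: "\<And>j. real_polynomial_function (g j)"
    and Fg: "\<And>j x. x \<in> Q \<Longrightarrow> \<bar>F x - g j x\<bar> < 1 / real (Suc j)"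
    by metis
  have "bounded (F ` Q)"
    by (intro compact_imp_bounded compact_continuous_image FQ \<open>compact Q\<close>)
  then obtain B where B: "\<forall>x\<in>Q. \<bar>F x\<bar> \<le> B" by (auto simp: bounded_iff)
  show ?thesis
  proof (rule multiplier_limit)
    show "multiplier (\<lambda>x. g j (proj x) * 1)" for j
      by (rule multiplier_polynomial[OF g multiplier_one])
    fix x :: "real ^ 'm" assume "x \<in> strip i\<^sub>0"
    then have x: "proj x \<in> Q" using proj_strip by (simp add: Q_def)
    \<comment> \<open>All approximation errors are below 1, which gives the uniform bound that
      \<open>multiplier_limit\<close> demands.\<close>
    show "\<bar>g j (proj x) * 1\<bar> \<le> B + 1" for j
    proof -
      have "1 / real (Suc j) \<le> 1" by simp
      then show ?thesis using Fg[OF x, of j] B[rule_format, OF x] by linarith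
    qed
    have "(\<lambda>j. g j (proj x)) \<longlonglongrightarrow> F (proj x)"
    proof (rule LIMSEQ_I)
      fix e :: real assume "0 < e"
      then obtain N where N: "1 / real (Suc N) < e" using nat_approx_posE by blast
      have "norm (g j (proj x) - F (proj x)) < e" if "j \<ge> N" for j
      proof -
        have "1 / real (Suc j) \<le> 1 / real (Suc N)" using that by (simp add: frac_le)
        then show ?thesis using Fg[OF x, of j] N by (simp add: abs_minus_commute)
      qed
      then show "\<exists>N. \<forall>j\<ge>N. norm (g j (proj x) - F (proj x)) < e" by blast
    qed
    then show "(\<lambda>j. g j (proj x) * 1) \<longlonglongrightarrow> F (proj x)" by simp
  qed
qed

lemma multiplier_closed_indicator:
  assumes "closed C" "C \<noteq> {}"
  shows "multiplier (\<lambda>x. indicator C (proj x))"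
proof (rule multiplier_limit)
  show "multiplier (\<lambda>x. max 0 (1 - real (Suc j) * infdist (proj x) C))" for j
    by (rule multiplier_continuous) (intro continuous_intros)
  show "\<bar>max 0 (1 - real (Suc j) * infdist (proj x) C)\<bar> \<le> 1" for j x
    using infdist_tent_range[of j "proj x" C] by auto
  show "(\<lambda>j. max 0 (1 - real (Suc j) * infdist (proj x) C)) \<longlonglongrightarrow> indicator C (proj x)" for x
    by (rule infdist_tent_tendsto[OF assms])
qed

section \<open>From boxes to all of \<open>Lp\<close>\<close>

lemma coordinate_inner: "x $ i\<^sub>0 = axis i\<^sub>0 1 \<bullet> x"
  by (simp add: inner_axis inner_commute[of "axis i\<^sub>0 1"])

lemma cbox_Lp: "indicator (cbox l r) \<in> Lp p (strip i\<^sub>0)"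
proof (rule Lp_bounded[OF p_nonneg slab_Lp[of "axis i\<^sub>0 1" 1 "l $ i\<^sub>0" "r $ i\<^sub>0"]])
  show "(axis i\<^sub>0 1 :: real ^ 'm) $ i\<^sub>0 = 1" by simp
  show "indicator (cbox l r) \<in> borel_measurable M"
    by (intro borel_measurable_lebesgue_on borel_measurable_indicator) simp
  show "AE x in M. \<bar>indicator (cbox l r) x\<bar> \<le> \<bar>1 * indicator {l $ i\<^sub>0..r $ i\<^sub>0} (axis i\<^sub>0 1 \<bullet> x) :: real\<bar>"
    unfolding coordinate_inner[symmetric] by (intro AE_I2) (auto simp: indicator_def mem_box_cart)
qed

lemma cbox_V: "indicator (cbox l r) \<in> V"
proof (cases "\<forall>i. l $ i \<le> r $ i")
  case False
  then obtain i where "r $ i < l $ i" by (auto simp: not_le)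
  then have "x \<notin> cbox l r" for x
    by (auto simp: mem_box_cart not_le intro!: exI[of _ i])
  then have "cbox l r = {}" by blast
  then show ?thesis using V_indicator_empty by simp
next
  case True
  \<comment> \<open>The box factors into a condition on \<open>proj x\<close> and one on
    \<open>x $ i\<^sub>0\<close>. The set \<open>C\<close> leaves the latter coordinate free, since
    \<open>proj\<close> overwrites it with 0.\<close>
  define C where "C = {y. \<forall>i. i \<noteq> i\<^sub>0 \<longrightarrow> l $ i \<le> y $ i \<and> y $ i \<le> r $ i}"
  define I where "I = {l $ i\<^sub>0..r $ i\<^sub>0}"
  have C_eq: "C = (\<Inter>i\<in>-{i\<^sub>0}. {y. l $ i \<le> y $ i} \<inter> {y. y $ i \<le> r $ i})"
    by (auto simp: C_def)
  have C: "closed C"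
    unfolding C_eq by (intro closed_INT ballI closed_Int closed_Collect_le continuous_intros)
  have C_ne: "C \<noteq> {}" using True by (auto simp: C_def)
  have I: "closed I" "I \<noteq> {}" using True by (auto simp: I_def)
  define G where "G = (\<lambda>k t. max 0 (1 - real (Suc k) * infdist t I))"
  \<comment> \<open>Beyond \<open>K\<close> the distance to \<open>I\<close> is at least 1, so every
    tent, having slope at least 1, is already 0; the supports share one bound.\<close>
  define K where "K = max \<bar>l $ i\<^sub>0\<bar> \<bar>r $ i\<^sub>0\<bar> + 1"
  have G0: "G k t = 0" if t: "K < \<bar>t\<bar>" for k t
  proof -
    have "1 \<le> infdist t I"
      unfolding infdist_notempty[OF I(2)]
      using I(2) t by (intro cINF_greatest) (auto simp: I_def K_def dist_real_def)
    then have "1 * 1 \<le> real (Suc k) * infdist t I"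
      by (intro mult_mono) auto
    then show ?thesis by (simp add: G_def)
  qed
  have G_cs: "cont_compact_support (G k)" for k
    using G0 unfolding cont_compact_support_def by (intro conjI exI[of _ K]) (auto simp: G_def intro!: continuous_intros)
  have eq: "indicator (cbox l r) x = (indicator C (proj x) * indicator I (axis i\<^sub>0 1 \<bullet> x) :: real)" for x
    unfolding coordinate_inner[symmetric]
    by (auto simp: indicator_def mem_box_cart C_def I_def proj_def)
  show ?thesis
  proof (rule V_limit)
    show "(\<lambda>x. indicator C (proj x) * G k (axis i\<^sub>0 1 \<bullet> x)) \<in> V" for k
      by (rule multiplier_V[OF multiplier_closed_indicator[OF C C_ne] G_cs]) simp
    show "(\<lambda>x. 1 * indicator {-K..K} (axis i\<^sub>0 1 \<bullet> x)) \<in> Lp p (strip i\<^sub>0)"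
      by (rule slab_Lp) simp
    show "indicator (cbox l r) \<in> borel_measurable M"
      by (intro borel_measurable_lebesgue_on borel_measurable_indicator) simp
    show "AE x in M. (\<lambda>k. indicator C (proj x) * G k (axis i\<^sub>0 1 \<bullet> x)) \<longlonglongrightarrow> indicator (cbox l r) x"
      unfolding eq G_def by (intro AE_I2 tendsto_mult_left infdist_tent_tendsto I)
    show "AE x in M. \<bar>indicator C (proj x) * G k (axis i\<^sub>0 1 \<bullet> x)\<bar> \<le> 1 * indicator {-K..K} (axis i\<^sub>0 1 \<bullet> x)" for k
    proof (intro AE_I2)
      fix x :: "real ^ 'm"
      have "\<bar>G k t\<bar> \<le> indicator {-K..K} t" for t
        using G0[of t k] infdist_tent_range[of k t I] unfolding G_def[symmetric]
        by (cases "K < \<bar>t\<bar>") (auto simp: G_def indicator_def)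
      from this[of "axis i\<^sub>0 1 \<bullet> x"] show "\<bar>indicator C (proj x) * G k (axis i\<^sub>0 1 \<bullet> x)\<bar> \<le> 1 * indicator {-K..K} (axis i\<^sub>0 1 \<bullet> x)"
        by (cases "proj x \<in> C") simp_all
    qed
  qed
qed

text \<open>Dynkin's theorem for the intersection-stable class of boxes. Intersecting with a fixed
  box keeps everything in \<open>Lp\<close>: complements become differences in \<open>V\<close>, and
  the box indicator dominates disjoint unions.\<close>

lemma bounded_borel_V:
  assumes "A \<in> sets borel"
  shows "indicator (A \<inter> cbox l r) \<in> V"
proof -
  let ?E = "range (\<lambda>(a, b). cbox a b :: (real ^ 'm) set)"
  have borel: "sets borel = sigma_sets UNIV ?E"
    by (subst borel_eq_atLeastAtMost) (simp add: interval_cbox_cart case_prod_unfold)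
  show ?thesis
  proof (rule sigma_sets_induct_disjoint[where G = ?E and \<Omega> = UNIV and A = A])
    show "Int_stable ?E" by (auto simp: Int_stable_def Int_interval)
    show "A \<in> sigma_sets UNIV ?E" using assms by (simp add: borel)
  next
    fix A assume "A \<in> ?E"
    then obtain a b where "A = cbox a b" by auto
    then show "indicator (A \<inter> cbox l r) \<in> V"
      using cbox_V by (simp add: Int_interval)
  next
    show "indicator ({} \<inter> cbox l r) \<in> V"
      using V_indicator_empty by simp
  next
    fix A :: "(real ^ 'm) set" assume "indicator (A \<inter> cbox l r) \<in> V"
    then have "(\<lambda>x. indicator (cbox l r) x - indicator (A \<inter> cbox l r) x) \<in> V"
      by (rule V_diff[OF cbox_V])
    moreover have "(\<lambda>x. indicator (cbox l r) x - indicator (A \<inter> cbox l r) x :: real) = indicator ((UNIV - A) \<inter> cbox l r)"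
      by (auto simp: indicator_def)
    ultimately show "indicator ((UNIV - A) \<inter> cbox l r) \<in> V" by simp
  next
    fix A :: "nat \<Rightarrow> (real ^ 'm) set"
    assume disj: "disjoint_family A" and A: "range A \<subseteq> sigma_sets UNIV ?E"
      and V: "\<And>i. indicator (A i \<inter> cbox l r) \<in> V"
    have disj': "disjoint_family (\<lambda>i. A i \<inter> cbox l r)"
      using disj by (auto simp: disjoint_family_on_def)
    have part: "(\<Sum>i<k. indicator (A i \<inter> cbox l r) x :: real) = indicator (\<Union>i<k. A i \<inter> cbox l r) x" for k x
      by (subst indicator_UN_disjoint) (use disj' in \<open>auto simp: disjoint_family_on_def\<close>)
    show "indicator ((\<Union>i. A i) \<inter> cbox l r) \<in> V"
    proof (rule V_limit[OF _ cbox_Lp[of l r]])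
      show "(\<lambda>x. \<Sum>i<k. indicator (A i \<inter> cbox l r) x) \<in> V" for k
        by (intro V_sum' V) simp
      have "(\<Union>i. A i) \<in> sets borel"
        using A unfolding borel[symmetric] by (rule sets.countable_UN)
      then show "indicator ((\<Union>i. A i) \<inter> cbox l r) \<in> borel_measurable M"
        by (intro borel_measurable_lebesgue_on borel_measurable_indicator) auto
      have "(\<Union>i. A i) \<inter> cbox l r = (\<Union>i. A i \<inter> cbox l r)" by blast
      then show "AE x in M. (\<lambda>k. \<Sum>i<k. indicator (A i \<inter> cbox l r) x) \<longlonglongrightarrow> (indicator ((\<Union>i. A i) \<inter> cbox l r) x :: real)"
        unfolding part by (simp only: LIMSEQ_indicator_UN AE_I2)
      show "AE x in M. \<bar>\<Sum>i<k. indicator (A i \<inter> cbox l r) x\<bar> \<le> (indicator (cbox l r) x :: real)" for k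
        unfolding part by (intro AE_I2) (auto simp: indicator_def)
    qed
  qed auto
qed

lemma V_simple:
  assumes s: "simple_function borel s"
  shows "(\<lambda>x. s x * indicator (cbox l r) x) \<in> V"
proof -
  have fin: "finite (range s)" and meas: "\<And>y. y \<in> range s \<Longrightarrow> s -` {y} \<in> sets borel"
    using s by (auto simp: simple_function_def)
  have eq: "s x * indicator (cbox l r) x = (\<Sum>y\<in>range s. y * indicator (s -` {y} \<inter> cbox l r) x)" for x
    using fin by (simp add: indicator_inter_arith indicator_def if_distrib sum.delta' cong: if_cong)
  show ?thesis
    unfolding eq by (intro V_sum' V_cmult bounded_borel_V fin meas)
qed

lemma V_eq_Lp: "V = Lp p (strip i\<^sub>0)"
proof (intro equalityI subsetI)
  fix f assume f: "f \<in> Lp p (strip i\<^sub>0)"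
  \<comment> \<open>Only Borel sets have been reached, so f is extended by 0 and exchanged for a
    Borel function equal to it almost everywhere on the strip.\<close>
  have "(\<lambda>x. if x \<in> strip i\<^sub>0 then f x else 0) \<in> borel_measurable (completion lborel)"
    using Lp_measurable[OF f] sets_strip[of i\<^sub>0] by (intro borel_measurable_if_I) auto
  then obtain g where g: "g \<in> borel_measurable borel"
    and "AE x in lborel. (if x \<in> strip i\<^sub>0 then f x else 0) = g x"
    using completion_ex_borel_measurable_real by force
  then have fg: "AE x in M. f x = g x"
    using sets_strip[of i\<^sub>0] by (subst AE_restrict_space_iff) (auto simp: AE_completion_iff elim!: eventually_mono)
  have gM: "g \<in> borel_measurable M" by (rule borel_measurable_lebesgue_on[OF g])
  have gL: "g \<in> Lp p (strip i\<^sub>0)"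
    by (rule Lp_bounded[OF p_nonneg f gM]) (use fg in auto)
  obtain s where s: "\<And>i. simple_function borel (s i)" "\<And>x. (\<lambda>i. s i x) \<longlonglongrightarrow> g x"
    and bd: "\<And>i x. \<bar>s i x\<bar> \<le> 2 * \<bar>g x\<bar>"
    using borel_measurable_implies_sequence_metric[OF g, of 0] by auto
  \<comment> \<open>Simple functions are available in \<open>V\<close> only after truncation to a
    box; these cubes exhaust the space, so the truncation disappears in the limit.\<close>
  define Q where "Q = (\<lambda>k. cbox (\<chi> i. - real k) (\<chi> i. real k) :: (real ^ 'm) set)"
  have "g \<in> V"
  proof (rule V_limit)
    show "(\<lambda>x. s k x * indicator (Q k) x) \<in> V" for k
      unfolding Q_def by (rule V_simple[OF s(1)])
    show "(\<lambda>x. \<bar>2 * g x\<bar>) \<in> Lp p (strip i\<^sub>0)"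
      using Lp_cmult[OF gL, of 2] gM by (auto simp: Lp_def)
    show "AE x in M. (\<lambda>k. s k x * indicator (Q k) x) \<longlonglongrightarrow> g x"
    proof (intro AE_I2)
      fix x :: "real ^ 'm"
      obtain N :: nat where N: "norm x \<le> real N" using real_arch_simple by blast
      have "x \<in> Q k" if "k \<ge> N" for k
      proof -
        have "\<bar>x $ i\<bar> \<le> real k" for i
          using component_le_norm_cart[of x i] N that by (smt (verit) of_nat_le_iff)
        then show ?thesis by (auto simp: Q_def mem_box_cart abs_le_iff minus_le_iff)
      qed
      then have "eventually (\<lambda>k. s k x = s k x * indicator (Q k) x) sequentially"
        by (intro eventually_sequentiallyI[of N]) simp
      then show "(\<lambda>k. s k x * indicator (Q k) x) \<longlonglongrightarrow> g x"
        using s(2) by (rule Lim_transform_eventually[rotated])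
    qed
    show "AE x in M. \<bar>s k x * indicator (Q k) x\<bar> \<le> \<bar>2 * g x\<bar>" for k
      using bd by (intro AE_I2) (auto simp: indicator_def abs_mult)
  qed (rule gM)
  then show "f \<in> V"
    by (rule V_AE[OF _ Lp_measurable[OF f]]) (use fg in auto)
qed (rule V_Lp)

end

subsection \<open>Approximation of intervals by increments of \<open>\<phi>\<close>\<close>

lemma null_set_escapes:
  fixes Z :: "real set"
  assumes "Z \<in> null_sets lborel" "c < d"
  shows "\<exists>t. c < t \<and> t < d \<and> t \<notin> Z"
proof (rule ccontr)
  assume "\<not> ?thesis"
  then have "{c<..<d} \<subseteq> Z" by auto
  then have "emeasure lborel {c<..<d} \<le> emeasure lborel Z"
    using assms(1) by (intro emeasure_mono) auto
  then show False using assms by (simp add: null_sets_def)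
qed

text \<open>Inequalities pass to a limit only along a nontrivial filter, and a null set cannot
  contain a half-line.\<close>

lemma at_top_off_null:
  assumes "Z \<in> null_sets lborel"
  shows "inf at_top (principal (- Z)) \<noteq> (bot :: real filter)"
proof
  assume "inf at_top (principal (- Z)) = (bot :: real filter)"
  then have "eventually (\<lambda>t. t \<in> Z) at_top"
    by (simp add: trivial_limit_def eventually_inf_principal)
  then obtain N where "\<And>t. N \<le> t \<Longrightarrow> t \<in> Z"
    by (auto simp: eventually_at_top_linorder)
  then show False
    using null_set_escapes[OF assms, of N "N + 1"] by auto
qed

lemma at_bot_off_null:
  assumes "Z \<in> null_sets lborel"
  shows "inf at_bot (principal (- Z)) \<noteq> (bot :: real filter)"
proof
  assume "inf at_bot (principal (- Z)) = (bot :: real filter)"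
  then have "eventually (\<lambda>t. t \<in> Z) at_bot"
    by (simp add: trivial_limit_def eventually_inf_principal)
  then obtain N where "\<And>t. t \<le> N \<Longrightarrow> t \<in> Z"
    by (auto simp: eventually_at_bot_linorder)
  then show False
    using null_set_escapes[OF assms, of "N - 1" N] by auto
qed

text \<open>The equation says that \<phi> t lies between \<phi> s and the limit a. It covers
  increasing and decreasing tails alike and is already in the form that telescopes.\<close>

lemma monotone_tail_at_top:
  assumes Z: "Z \<in> null_sets lborel" and mono: "monotone_fun ({X<..} - Z) \<phi>"
    and lim: "(\<phi> \<longlongrightarrow> a) (inf at_top (principal (- Z)))"
    and s: "X < s" "s \<notin> Z" and t: "s \<le> t" "t \<notin> Z"
  shows "\<bar>\<phi> t - \<phi> s\<bar> + \<bar>\<phi> t - a\<bar> = \<bar>\<phi> s - a\<bar>"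
proof -
  have ev: "eventually (\<lambda>x. x \<in> {X<..} - Z \<and> t \<le> x) (inf at_top (principal (- Z)))"
    using eventually_ge_at_top[of "max (X + 1) t"]
    by (auto simp: eventually_inf_principal elim!: eventually_mono)
  have st: "s \<in> {X<..} - Z" "t \<in> {X<..} - Z" using s t by auto
  from mono show ?thesis
    unfolding monotone_fun_def
  proof
    assume m: "mono_on ({X<..} - Z) \<phi>"
    have "\<phi> t \<le> a"
      by (rule tendsto_lowerbound[OF lim _ at_top_off_null[OF Z]])
        (use ev in \<open>eventually_elim; use mono_onD[OF m st(2)] in auto\<close>)
    then show ?thesis using mono_onD[OF m st t(1)] by linarith
  next
    assume m: "antimono_on ({X<..} - Z) \<phi>"
    have "a \<le> \<phi> t"
      by (rule tendsto_upperbound[OF lim _ at_top_off_null[OF Z]])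
        (use ev in \<open>eventually_elim; use monotone_onD[OF m st(2)] in auto\<close>)
    then show ?thesis using monotone_onD[OF m st t(1)] by linarith
  qed
qed

lemma monotone_tail_at_bot:
  assumes Z: "Z \<in> null_sets lborel" and mono: "monotone_fun ({..<-X} - Z) \<phi>"
    and lim: "(\<phi> \<longlongrightarrow> b) (inf at_bot (principal (- Z)))"
    and s: "s < -X" "s \<notin> Z" and t: "t \<le> s" "t \<notin> Z"
  shows "\<bar>\<phi> t - \<phi> s\<bar> + \<bar>\<phi> t - b\<bar> = \<bar>\<phi> s - b\<bar>"
proof -
  have ev: "eventually (\<lambda>x. x \<in> {..<-X} - Z \<and> x \<le> t) (inf at_bot (principal (- Z)))"
    using eventually_le_at_bot[of "min (-X - 1) t"]
    by (auto simp: eventually_inf_principal elim!: eventually_mono)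
  have st: "s \<in> {..<-X} - Z" "t \<in> {..<-X} - Z" using s t by auto
  from mono show ?thesis
    unfolding monotone_fun_def
  proof
    assume m: "mono_on ({..<-X} - Z) \<phi>"
    have "b \<le> \<phi> t"
      by (rule tendsto_upperbound[OF lim _ at_bot_off_null[OF Z]])
        (use ev in \<open>eventually_elim; use mono_onD[OF m _ st(2)] in auto\<close>)
    then show ?thesis using mono_onD[OF m st(2,1) t(1)] by linarith
  next
    assume m: "antimono_on ({..<-X} - Z) \<phi>"
    have "\<phi> t \<le> b"
      by (rule tendsto_lowerbound[OF lim _ at_bot_off_null[OF Z]])
        (use ev in \<open>eventually_elim; use monotone_onD[OF m _ st(2)] in auto\<close>)
    then show ?thesis using monotone_onD[OF m st(2,1) t(1)] by linarith
  qed
qed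

section \<open>Integral bounds for increments of functions with monotone tails\<close>

lemma nn_integral_shift:
  fixes f :: "real \<Rightarrow> ennreal"
  assumes "f \<in> borel_measurable borel"
  shows "(\<integral>\<^sup>+t. f (t + L) \<partial>lborel) = (\<integral>\<^sup>+t. f t \<partial>lborel)"
  using nn_integral_real_affine[OF assms, of 1 L] by (simp add: add.commute)

lemma nn_integral_reflect:
  fixes f :: "real \<Rightarrow> ennreal"
  assumes "f \<in> borel_measurable borel"
  shows "(\<integral>\<^sup>+t. f (L - t) \<partial>lborel) = (\<integral>\<^sup>+t. f t \<partial>lborel)"
  using nn_integral_real_affine[OF assms, of "-1" L] by simp

text \<open>
  Telescoping: over a window of length \<open>n\<close>, the decrements \<open>D t = m t - m (t + L)\<close> integrate to
  at most the first block of length \<open>L\<close>.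
\<close>
lemma nn_integral_decrement_le:
  fixes D m :: "real \<Rightarrow> ennreal"
  assumes [measurable]: "D \<in> borel_measurable borel" "m \<in> borel_measurable borel"
    and m: "\<And>t. m t \<le> C" "C < \<infinity>" and L: "0 \<le> L"
    and dec: "AE t in lborel. X < t \<longrightarrow> D t + m (t + L) = m t"
  shows "(\<integral>\<^sup>+t\<in>{X<..}. D t \<partial>lborel) \<le> (\<integral>\<^sup>+t\<in>{X<..X + L}. m t \<partial>lborel)"
proof -
  have fin: "(\<integral>\<^sup>+t\<in>{c<..d}. m t \<partial>lborel) \<noteq> \<infinity>" for c d
  proof -
    have "(\<integral>\<^sup>+t\<in>{c<..d}. m t \<partial>lborel) \<le> (\<integral>\<^sup>+t. C * indicator {c<..d} t \<partial>lborel)"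
      by (intro nn_integral_mono mult_right_mono m) simp
    also have "\<dots> < \<infinity>"
      using m(2) by (cases "c \<le> d") (simp_all add: nn_integral_cmult ennreal_mult_less_top)
    finally show ?thesis by simp
  qed
  \<comment> \<open>The integral of m over the whole half-line may be infinite, and
    \<open>ennreal\<close> admits cancellation only of finite terms; hence bounded windows first and
    a monotone limit afterwards.\<close>
  have bound: "(\<integral>\<^sup>+t\<in>{X<..X + real n}. D t \<partial>lborel) \<le> (\<integral>\<^sup>+t\<in>{X<..X + L}. m t \<partial>lborel)" for n
  proof -
    let ?Y = "X + real n"
    have "(\<integral>\<^sup>+t\<in>{X<..?Y}. D t \<partial>lborel) + (\<integral>\<^sup>+t\<in>{X + L<..?Y + L}. m t \<partial>lborel)
        = (\<integral>\<^sup>+t\<in>{X<..?Y}. D t \<partial>lborel) + (\<integral>\<^sup>+t\<in>{X<..?Y}. m (t + L) \<partial>lborel)"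
      by (subst nn_integral_shift[symmetric, of _ L]) (auto intro!: nn_integral_cong simp: indicator_def)
    also have "\<dots> = (\<integral>\<^sup>+t. D t * indicator {X<..?Y} t + m (t + L) * indicator {X<..?Y} t \<partial>lborel)"
      by (rule nn_integral_add[symmetric]) measurable
    also have "\<dots> = (\<integral>\<^sup>+t\<in>{X<..?Y}. m t \<partial>lborel)"
      using dec by (intro nn_integral_cong_AE) (auto elim!: eventually_mono simp: indicator_def)
    also have "\<dots> \<le> (\<integral>\<^sup>+t. m t * indicator {X<..X + L} t + m t * indicator {X + L<..?Y + L} t \<partial>lborel)"
      using L by (intro nn_integral_mono) (auto simp: indicator_def)
    also have "\<dots> = (\<integral>\<^sup>+t\<in>{X<..X + L}. m t \<partial>lborel) + (\<integral>\<^sup>+t\<in>{X + L<..?Y + L}. m t \<partial>lborel)"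
      by (rule nn_integral_add) measurable
    finally show ?thesis
      using fin by (simp add: ennreal_add_left_cancel_le add.commute[of _ "\<integral>\<^sup>+t\<in>{X + L<..?Y + L}. m t \<partial>lborel"])
  qed
  have "{X<..} = (\<Union>n. {X<..X + real n})"
    by (auto, metis add.commute diff_le_eq real_arch_simple)
  then have "(\<integral>\<^sup>+t\<in>{X<..}. D t \<partial>lborel) = emeasure (density lborel D) (\<Union>n. {X<..X + real n})"
    by (simp add: emeasure_density)
  also have "\<dots> = (SUP n. emeasure (density lborel D) {X<..X + real n})"
    by (rule SUP_emeasure_incseq[symmetric]) (auto simp: incseq_def)
  also have "\<dots> \<le> (\<integral>\<^sup>+t\<in>{X<..X + L}. m t \<partial>lborel)"
    using bound by (intro SUP_least) (simp add: emeasure_density)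
  finally show ?thesis .
qed

text \<open>The factor 4 counts one block integral for each telescoping tail and two for the middle
  part, where the increment is bounded by the triangle inequality.\<close>

lemma nn_integral_increment_le:
  fixes \<theta> :: "real \<Rightarrow> real"
  assumes [measurable]: "\<theta> \<in> borel_measurable borel" and C: "\<And>t. \<bar>\<theta> t\<bar> \<le> C"
    and L: "0 \<le> L" and X: "0 \<le> X"
    and right: "AE t in lborel. X < t \<longrightarrow> \<bar>\<theta> (t + L) - \<theta> t\<bar> + \<bar>\<theta> (t + L)\<bar> = \<bar>\<theta> t\<bar>"
    and left: "AE t in lborel. X < t \<longrightarrow> \<bar>\<theta> (- (t + L)) - \<theta> (- t)\<bar> + \<bar>\<theta> (- (t + L))\<bar> = \<bar>\<theta> (- t)\<bar>"
  shows "(\<integral>\<^sup>+t. ennreal \<bar>\<theta> (t + L) - \<theta> t\<bar> \<partial>lborel)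
    \<le> 4 * (\<integral>\<^sup>+t\<in>{-(X + L)..X + L}. ennreal \<bar>\<theta> t\<bar> \<partial>lborel)"
proof -
  define D where "D = (\<lambda>t. ennreal \<bar>\<theta> (t + L) - \<theta> t\<bar>)"
  define m where "m = (\<lambda>t. ennreal \<bar>\<theta> t\<bar>)"
  define J where "J = (\<integral>\<^sup>+t\<in>{-(X + L)..X + L}. m t \<partial>lborel)"
  have [measurable]: "D \<in> borel_measurable borel" "m \<in> borel_measurable borel"
    unfolding D_def m_def by measurable
  have mC: "m t \<le> ennreal C" for t
    unfolding m_def by (rule ennreal_leI) (rule C)
  have "(\<integral>\<^sup>+t\<in>{X<..}. D t \<partial>lborel) \<le> (\<integral>\<^sup>+t\<in>{X<..X + L}. m t \<partial>lborel)"
    by (rule nn_integral_decrement_le[OF _ _ mC]) (use L right in \<open>auto simp: D_def m_def simp flip: ennreal_plus elim!: eventually_mono\<close>)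
  also have "\<dots> \<le> J"
    unfolding J_def using X L by (intro nn_integral_mono) (auto simp: indicator_def)
  finally have 1: "(\<integral>\<^sup>+t\<in>{X<..}. D t \<partial>lborel) \<le> J" .
  \<comment> \<open>The reflection t -> -L - t turns the increment from t to t + L into the one
    between -(t + L) and -t, so the left tail is handled like the right one.\<close>
  have "(\<integral>\<^sup>+t\<in>{..<-(X + L)}. D t \<partial>lborel) = (\<integral>\<^sup>+t\<in>{X<..}. D (- L - t) \<partial>lborel)"
    by (subst nn_integral_reflect[symmetric, of _ "- L"]) (auto intro!: nn_integral_cong simp: indicator_def)
  also have "\<dots> \<le> (\<integral>\<^sup>+t\<in>{X<..X + L}. m (- t) \<partial>lborel)"
    by (rule nn_integral_decrement_le[OF _ _ mC])
      (use L left in \<open>auto simp: D_def m_def minus_diff_commute[of L] abs_minus_commute simp flip: ennreal_plus elim!: eventually_mono\<close>)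
  also have "\<dots> = (\<integral>\<^sup>+t\<in>{-(X + L)..<-X}. m t \<partial>lborel)"
    by (subst nn_integral_reflect[symmetric, of _ 0]) (auto intro!: nn_integral_cong simp: indicator_def)
  also have "\<dots> \<le> J"
    unfolding J_def using X L by (intro nn_integral_mono) (auto simp: indicator_def)
  finally have 2: "(\<integral>\<^sup>+t\<in>{..<-(X + L)}. D t \<partial>lborel) \<le> J" .
  have "(\<integral>\<^sup>+t\<in>{-(X + L)..X}. D t \<partial>lborel)
      \<le> (\<integral>\<^sup>+t. m (t + L) * indicator {-(X + L)..X} t + m t * indicator {-(X + L)..X} t \<partial>lborel)"
    by (intro nn_integral_mono) (auto simp: indicator_def D_def m_def simp flip: ennreal_plus intro!: ennreal_leI)
  also have "\<dots> = (\<integral>\<^sup>+t\<in>{-(X + L)..X}. m (t + L) \<partial>lborel) + (\<integral>\<^sup>+t\<in>{-(X + L)..X}. m t \<partial>lborel)"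
    by (rule nn_integral_add) measurable
  also have "(\<integral>\<^sup>+t\<in>{-(X + L)..X}. m (t + L) \<partial>lborel) = (\<integral>\<^sup>+t\<in>{-X..X + L}. m t \<partial>lborel)"
    by (subst nn_integral_shift[symmetric, of "\<lambda>t. m t * indicator {-X..X + L} t" L]) (auto intro!: nn_integral_cong simp: indicator_def)
  also have "\<dots> \<le> J"
    unfolding J_def using X L by (intro nn_integral_mono) (auto simp: indicator_def)
  also have "(\<integral>\<^sup>+t\<in>{-(X + L)..X}. m t \<partial>lborel) \<le> J"
    unfolding J_def using X L by (intro nn_integral_mono) (auto simp: indicator_def)
  finally have 3: "(\<integral>\<^sup>+t\<in>{-(X + L)..X}. D t \<partial>lborel) \<le> J + J"
    by (simp add: add_mono)
  have "(\<integral>\<^sup>+t. D t \<partial>lborel) = (\<integral>\<^sup>+t. D t * indicator {X<..} t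
      + (D t * indicator {..<-(X + L)} t + D t * indicator {-(X + L)..X} t) \<partial>lborel)"
    using X L by (intro nn_integral_cong) (auto simp: indicator_def)
  also have "\<dots> = (\<integral>\<^sup>+t\<in>{X<..}. D t \<partial>lborel)
      + ((\<integral>\<^sup>+t\<in>{..<-(X + L)}. D t \<partial>lborel) + (\<integral>\<^sup>+t\<in>{-(X + L)..X}. D t \<partial>lborel))"
    by (simp add: nn_integral_add)
  also have "\<dots> \<le> J + (J + (J + J))"
    by (intro add_mono 1 2 3)
  also have "\<dots> = 4 * J"
  proof -
    have "(4 :: ennreal) = 1 + (1 + (1 + 1))" by simp
    then show ?thesis by (simp only: distrib_right mult_1)
  qed
  finally show ?thesis by (simp add: D_def J_def m_def)
qed

subsection \<open>Ridge sums\<close>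

lemma ridge_sums_single: "(\<lambda>x. \<phi> (y \<bullet> x + \<rho>)) \<in> ridge_sums \<phi>"
  unfolding ridge_sums_def
  by (intro CollectI exI[of _ 1] exI[of _ "\<lambda>_. 1"] exI[of _ "\<lambda>_. y"] exI[of _ "\<lambda>_. \<rho>"]) simp

lemma ridge_sumsE:
  assumes "f \<in> ridge_sums \<phi>"
  obtains k :: nat and t y \<rho> where "f = (\<lambda>x. \<Sum>i<k. t i * \<phi> (y i \<bullet> x + \<rho> i))"
  using assms that unfolding ridge_sums_def mem_Collect_eq by (elim exE conjE)

lemma ridge_sums_cmult:
  assumes "f \<in> ridge_sums \<phi>"
  shows "(\<lambda>x. c * f x) \<in> ridge_sums \<phi>"
proof -
  obtain k :: nat and t y \<rho> where "f = (\<lambda>x. \<Sum>i<k. t i * \<phi> (y i \<bullet> x + \<rho> i))"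
    by (rule ridge_sumsE[OF assms])
  then show ?thesis
    unfolding ridge_sums_def
    by (intro CollectI exI[of _ k] exI[of _ "\<lambda>i. c * t i"] exI[of _ y] exI[of _ \<rho>])
      (simp add: sum_distrib_left mult.assoc)
qed

lemma ridge_sums_add:
  assumes "f \<in> ridge_sums \<phi>" "g \<in> ridge_sums \<phi>"
  shows "(\<lambda>x. f x + g x) \<in> ridge_sums \<phi>"
proof -
  obtain k :: nat and t y \<rho> where f: "f = (\<lambda>x. \<Sum>i<k. t i * \<phi> (y i \<bullet> x + \<rho> i))"
    by (rule ridge_sumsE[OF assms(1)])
  obtain k' :: nat and t' y' \<rho>' where g: "g = (\<lambda>x. \<Sum>i<k'. t' i * \<phi> (y' i \<bullet> x + \<rho>' i))"
    by (rule ridge_sumsE[OF assms(2)])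
  have split: "(\<Sum>i<k + k'. h i) = (\<Sum>i<k. h i) + (\<Sum>i<k'. h (k + i))" for h :: "nat \<Rightarrow> real"
    by (induction k') (simp_all add: add.assoc)
  show ?thesis
    unfolding ridge_sums_def
    by (intro CollectI exI[of _ "k + k'"] exI[of _ "\<lambda>i. if i < k then t i else t' (i - k)"]
        exI[of _ "\<lambda>i. if i < k then y i else y' (i - k)"] exI[of _ "\<lambda>i. if i < k then \<rho> i else \<rho>' (i - k)"])
      (simp add: split f g)
qed

lemma null_sets_lebesgue_borel_superset:
  assumes "Z \<in> null_sets lebesgue"
  obtains Z' where "Z' \<in> null_sets lborel" "Z \<subseteq> Z'"
  using assms by (auto simp: null_sets_completion_iff2)

text \<open>Increments of the step part give interval indicators exactly, so the approximation error
  comes from the remainder \<theta> alone. All exceptional sets are merged into one Borel null set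
  Z.\<close>

lemma sigmoidal_decomposition:
  fixes \<phi> :: "real \<Rightarrow> real"
  assumes meas: "\<phi> \<in> borel_measurable lebesgue"
    and bdd: "essentially bounded_fun UNIV \<phi>"
    and mono: "eventually_essentially monotone_fun \<phi>"
    and top: "ae_tendsto \<phi> a at_top" and bot: "ae_tendsto \<phi> b at_bot"
  obtains \<theta> Z X C where "\<theta> \<in> borel_measurable borel" "Z \<in> null_sets lborel" "0 < X" "0 \<le> C"
    "\<And>t. \<bar>\<theta> t\<bar> \<le> C"
    "\<And>t. t \<notin> Z \<Longrightarrow> \<phi> t = \<theta> t + (if 0 < t then a else b)"
    "\<And>s t. X < s \<Longrightarrow> s \<le> t \<Longrightarrow> s \<notin> Z \<Longrightarrow> t \<notin> Z \<Longrightarrow> \<bar>\<theta> t - \<theta> s\<bar> + \<bar>\<theta> t\<bar> = \<bar>\<theta> s\<bar>"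
    "\<And>s t. s < -X \<Longrightarrow> t \<le> s \<Longrightarrow> s \<notin> Z \<Longrightarrow> t \<notin> Z \<Longrightarrow> \<bar>\<theta> t - \<theta> s\<bar> + \<bar>\<theta> t\<bar> = \<bar>\<theta> s\<bar>"
    "(\<theta> \<longlongrightarrow> 0) (inf at_top (principal (- Z)))" "(\<theta> \<longlongrightarrow> 0) (inf at_bot (principal (- Z)))"
proof -
  obtain \<phi>' where \<phi>': "\<phi>' \<in> borel_measurable lborel" "AE t in lborel. \<phi> t = \<phi>' t"
    using completion_ex_borel_measurable_real[OF meas] by blast
  obtain Z\<^sub>0 where Z\<^sub>0: "Z\<^sub>0 \<in> null_sets lborel" "{t. \<phi> t \<noteq> \<phi>' t} \<subseteq> Z\<^sub>0"
    using \<phi>'(2) by (auto simp: eventually_ae_filter)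
  obtain Z\<^sub>1 where Z\<^sub>1: "Z\<^sub>1 \<in> null_sets lebesgue" "bounded (\<phi> ` (UNIV - Z\<^sub>1))"
    using bdd by (auto simp: essentially_def bounded_fun_def)
  obtain X Z\<^sub>2 Z\<^sub>3 where X: "0 < X" and Z\<^sub>2: "Z\<^sub>2 \<in> null_sets lebesgue" "monotone_fun ({X<..} - Z\<^sub>2) \<phi>"
    and Z\<^sub>3: "Z\<^sub>3 \<in> null_sets lebesgue" "monotone_fun ({..<-X} - Z\<^sub>3) \<phi>"
    using mono by (auto simp: eventually_essentially_def essentially_def)
  obtain Z\<^sub>4 where Z\<^sub>4: "Z\<^sub>4 \<in> null_sets lebesgue" "(\<phi> \<longlongrightarrow> a) (inf at_top (principal (- Z\<^sub>4)))"
    using top by (auto simp: ae_tendsto_def)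
  obtain Z\<^sub>5 where Z\<^sub>5: "Z\<^sub>5 \<in> null_sets lebesgue" "(\<phi> \<longlongrightarrow> b) (inf at_bot (principal (- Z\<^sub>5)))"
    using bot by (auto simp: ae_tendsto_def)
  have "Z\<^sub>0 \<union> Z\<^sub>1 \<union> Z\<^sub>2 \<union> Z\<^sub>3 \<union> Z\<^sub>4 \<union> Z\<^sub>5 \<in> null_sets lebesgue"
    by (intro null_sets.Un Z\<^sub>1(1) Z\<^sub>2(1) Z\<^sub>3(1) Z\<^sub>4(1) Z\<^sub>5(1) null_sets_completionI[OF Z\<^sub>0(1)])
  then obtain Z where Z: "Z \<in> null_sets lborel"
    and sub: "Z\<^sub>0 \<union> Z\<^sub>1 \<union> Z\<^sub>2 \<union> Z\<^sub>3 \<union> Z\<^sub>4 \<union> Z\<^sub>5 \<subseteq> Z"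
    by (rule null_sets_lebesgue_borel_superset)
  obtain C where C: "\<And>t. t \<notin> Z\<^sub>1 \<Longrightarrow> \<bar>\<phi> t\<bar> \<le> C"
    using Z\<^sub>1(2) by (auto simp: bounded_iff)
  \<comment> \<open>The value b at 0 makes increments of \<open>H\<close> match intervals open on
    the left and closed on the right.\<close>
  define H where "H = (\<lambda>t::real. if 0 < t then a else b)"
  \<comment> \<open>The value 0 on Z makes the bound on \<theta> hold everywhere; using the Borel
    version \<open>\<phi>'\<close> makes \<theta> Borel.\<close>
  define \<theta> where "\<theta> = (\<lambda>t. if t \<in> Z then 0 else \<phi>' t - H t)"
  have \<theta>: "\<theta> t = \<phi> t - H t" if "t \<notin> Z" for t
  proof -
    have "\<phi> t = \<phi>' t" using that sub Z\<^sub>0(2) by blast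
    then show ?thesis using that by (simp add: \<theta>_def)
  qed
  have "{X<..} - Z \<subseteq> {X<..} - Z\<^sub>2" "{..<-X} - Z \<subseteq> {..<-X} - Z\<^sub>3"
    using sub by auto
  then have monoX: "monotone_fun ({X<..} - Z) \<phi>" "monotone_fun ({..<-X} - Z) \<phi>"
    using Z\<^sub>2(2) Z\<^sub>3(2) unfolding monotone_fun_def by (auto intro: monotone_on_subset)
  have lim: "(\<phi> \<longlongrightarrow> a) (inf at_top (principal (- Z)))" "(\<phi> \<longlongrightarrow> b) (inf at_bot (principal (- Z)))"
    using sub by (auto intro!: tendsto_mono[OF _ Z\<^sub>4(2)] tendsto_mono[OF _ Z\<^sub>5(2)] inf_mono)
  show ?thesis
  proof (rule that[of \<theta> Z X "\<bar>C\<bar> + \<bar>a\<bar> + \<bar>b\<bar>"])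
    have [measurable]: "\<phi>' \<in> borel_measurable borel" "Z \<in> sets borel"
      using \<phi>'(1) Z by auto
    show "\<theta> \<in> borel_measurable borel"
      unfolding \<theta>_def H_def by measurable
    show "\<bar>\<theta> t\<bar> \<le> \<bar>C\<bar> + \<bar>a\<bar> + \<bar>b\<bar>" for t
    proof (cases "t \<in> Z")
      case True
      then show ?thesis by (simp add: \<theta>_def)
    next
      case False
      then have "\<bar>\<phi> t\<bar> \<le> C" using C sub by auto
      moreover have "\<bar>H t\<bar> \<le> \<bar>a\<bar> + \<bar>b\<bar>" by (simp add: H_def)
      ultimately show ?thesis using \<theta>[OF False] by linarith
    qed
    show "\<phi> t = \<theta> t + (if 0 < t then a else b)" if "t \<notin> Z" for t
      using \<theta>[OF that] by (simp add: H_def)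
    show "\<bar>\<theta> t - \<theta> s\<bar> + \<bar>\<theta> t\<bar> = \<bar>\<theta> s\<bar>" if "X < s" "s \<le> t" "s \<notin> Z" "t \<notin> Z" for s t
      using monotone_tail_at_top[OF Z monoX(1) lim(1) that(1,3,2,4)] X that \<theta> by (simp add: H_def)
    show "\<bar>\<theta> t - \<theta> s\<bar> + \<bar>\<theta> t\<bar> = \<bar>\<theta> s\<bar>" if "s < -X" "t \<le> s" "s \<notin> Z" "t \<notin> Z" for s t
      using monotone_tail_at_bot[OF Z monoX(2) lim(2) that(1,3,2,4)] X that \<theta> by (simp add: H_def)
    have "((\<lambda>t. \<phi> t - a) \<longlongrightarrow> 0) (inf at_top (principal (- Z)))"
      using lim(1) by (rule LIM_zero)
    moreover have "eventually (\<lambda>t. \<phi> t - a = \<theta> t) (inf at_top (principal (- Z)))"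
      unfolding eventually_inf_principal using eventually_gt_at_top[of 0]
      by eventually_elim (use \<theta> in \<open>auto simp: H_def\<close>)
    ultimately show "(\<theta> \<longlongrightarrow> 0) (inf at_top (principal (- Z)))"
      by (rule Lim_transform_eventually)
    have "((\<lambda>t. \<phi> t - b) \<longlongrightarrow> 0) (inf at_bot (principal (- Z)))"
      using lim(2) by (rule LIM_zero)
    moreover have "eventually (\<lambda>t. \<phi> t - b = \<theta> t) (inf at_bot (principal (- Z)))"
      unfolding eventually_inf_principal using eventually_le_at_bot[of 0]
      by eventually_elim (use \<theta> in \<open>auto simp: H_def\<close>)
    ultimately show "(\<theta> \<longlongrightarrow> 0) (inf at_bot (principal (- Z)))"
      by (rule Lim_transform_eventually)
  qed (use Z X in auto)
qed

section \<open>Vanishing of rescaled increments\<close>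

lemma AE_affine_notin_null:
  fixes Z :: "real set"
  assumes "Z \<in> null_sets lborel" "c \<noteq> 0"
  shows "AE t in lborel. t0 + c * t \<notin> Z"
proof -
  have [measurable]: "Z \<in> sets borel" using assms(1) by auto
  show ?thesis
    by (rule AE_borel_affine[OF assms(2), where P = "\<lambda>x. x \<notin> Z"]) (use AE_not_in[OF assms(1)] in auto)
qed

text \<open>For almost every t no multiple (k+1) t falls into Z, because only countably many null
  sets are excluded. If also t \<noteq> 0, the multiples run to one of the infinities and \<theta>
  tends to 0 along them; the constant C dominates on the bounded interval.\<close>

lemma nn_integral_rescaled_tendsto_zero:
  fixes \<theta> :: "real \<Rightarrow> real"
  assumes [measurable]: "\<theta> \<in> borel_measurable borel" and Z: "Z \<in> null_sets lborel"
    and C: "\<And>t. \<bar>\<theta> t\<bar> \<le> C"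
    and top: "(\<theta> \<longlongrightarrow> 0) (inf at_top (principal (- Z)))"
    and bot: "(\<theta> \<longlongrightarrow> 0) (inf at_bot (principal (- Z)))"
  shows "(\<lambda>k. \<integral>\<^sup>+t\<in>{-Y..Y}. ennreal \<bar>\<theta> (real (Suc k) * t)\<bar> \<partial>lborel) \<longlonglongrightarrow> 0"
proof -
  have "(\<lambda>k. \<integral>\<^sup>+t\<in>{-Y..Y}. ennreal \<bar>\<theta> (real (Suc k) * t)\<bar> \<partial>lborel) \<longlonglongrightarrow> (\<integral>\<^sup>+t. 0 \<partial>(lborel :: real measure))"
  proof (rule nn_integral_dominated_convergence)
    show "AE t in lborel. ennreal \<bar>\<theta> (real (Suc k) * t)\<bar> * indicator {-Y..Y} t \<le> ennreal C * indicator {-Y..Y} t" for k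
      by (intro AE_I2 mult_right_mono ennreal_leI C) simp
    show "(\<integral>\<^sup>+t. ennreal C * indicator {-Y..Y} t \<partial>lborel) < \<infinity>"
      by (simp add: nn_integral_cmult emeasure_lborel_Icc_eq ennreal_mult_less_top)
    have "AE t in lborel. \<forall>k. 0 + real (Suc k) * t \<notin> Z"
      unfolding AE_all_countable by (intro allI AE_affine_notin_null Z) simp
    moreover have "AE t in lborel. t \<noteq> (0::real)"
      by (rule AE_lborel_singleton)
    ultimately show "AE t in lborel. (\<lambda>k. ennreal \<bar>\<theta> (real (Suc k) * t)\<bar> * indicator {-Y..Y} t) \<longlonglongrightarrow> 0"
    proof eventually_elim
      case (elim t)
      have out: "filterlim (\<lambda>k. real (Suc k) * t) (principal (- Z)) sequentially"
        using elim(1) by (simp add: filterlim_principal)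
      have nat: "filterlim (\<lambda>k. real (Suc k)) at_top sequentially"
        by (rule filterlim_compose[OF filterlim_real_sequentially filterlim_Suc])
      have "(\<lambda>k. \<theta> (real (Suc k) * t)) \<longlonglongrightarrow> 0"
      proof (cases "0 < t")
        case True
        then have "filterlim (\<lambda>k. real (Suc k) * t) at_top sequentially"
          by (intro filterlim_at_top_mult_tendsto_pos[OF tendsto_const _ nat])
        then show ?thesis
          using out by (intro filterlim_compose[OF top]) (simp add: filterlim_inf)
      next
        case False
        then have "t < 0" using elim(2) by simp
        then have "filterlim (\<lambda>k. real (Suc k) * t) at_bot sequentially"
          using filterlim_tendsto_neg_mult_at_bot[OF tendsto_const _ nat, of t] by (simp add: mult.commute)
        then show ?thesis
          using out by (intro filterlim_compose[OF bot]) (simp add: filterlim_inf)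
      qed
      then have "(\<lambda>k. ennreal \<bar>\<theta> (real (Suc k) * t)\<bar>) \<longlonglongrightarrow> ennreal \<bar>0\<bar>"
        by (intro tendsto_ennrealI tendsto_rabs)
      then show ?case
        by (cases "t \<in> {-Y..Y}") auto
    qed
  qed measurable
  then show ?thesis by simp
qed

text \<open>Increments are bounded by 2C, so |h|^p <= (2C)^(p-1) |h| reduces the claim to p = 1,
  where the increment bound leaves an integral over one fixed interval.\<close>

lemma rescaled_increment_Lp_tendsto_zero:
  fixes \<theta> :: "real \<Rightarrow> real"
  assumes \<theta>[measurable]: "\<theta> \<in> borel_measurable borel" and Z: "Z \<in> null_sets lborel"
    and C: "0 \<le> C" "\<And>t. \<bar>\<theta> t\<bar> \<le> C" and X: "0 < X" and L: "0 < L" and p: "1 \<le> p"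
    and right: "\<And>s t. X < s \<Longrightarrow> s \<le> t \<Longrightarrow> s \<notin> Z \<Longrightarrow> t \<notin> Z \<Longrightarrow> \<bar>\<theta> t - \<theta> s\<bar> + \<bar>\<theta> t\<bar> = \<bar>\<theta> s\<bar>"
    and left: "\<And>s t. s < -X \<Longrightarrow> t \<le> s \<Longrightarrow> s \<notin> Z \<Longrightarrow> t \<notin> Z \<Longrightarrow> \<bar>\<theta> t - \<theta> s\<bar> + \<bar>\<theta> t\<bar> = \<bar>\<theta> s\<bar>"
    and top: "(\<theta> \<longlongrightarrow> 0) (inf at_top (principal (- Z)))"
    and bot: "(\<theta> \<longlongrightarrow> 0) (inf at_bot (principal (- Z)))"
  shows "(\<lambda>k. \<integral>\<^sup>+t. ennreal (\<bar>\<theta> (real (Suc k) * (t + L)) - \<theta> (real (Suc k) * t)\<bar> powr p) \<partial>lborel) \<longlonglongrightarrow> 0"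
proof -
  define J where "J = (\<lambda>k. \<integral>\<^sup>+t\<in>{-(X + L)..X + L}. ennreal \<bar>\<theta> (real (Suc k) * t)\<bar> \<partial>lborel)"
  have J: "J \<longlonglongrightarrow> 0"
    unfolding J_def by (rule nn_integral_rescaled_tendsto_zero[OF \<theta> Z C(2) top bot])
  have est: "(\<integral>\<^sup>+t. ennreal (\<bar>\<theta> (real (Suc k) * (t + L)) - \<theta> (real (Suc k) * t)\<bar> powr p) \<partial>lborel)
      \<le> ennreal ((2 * C) powr (p - 1)) * (4 * J k)" for k
  proof -
    define c where "c = real (Suc k)"
    have c: "1 \<le> c" by (simp add: c_def)
    \<comment> \<open>A scale of at least 1 moves points further into the tails, so the rescaled
      functions satisfy the tail conditions with the same X and the interval in \<open>J\<close>
      does not depend on k.\<close>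
    have cX: "X < c * t" if "X < t" for t
    proof -
      have "1 * t \<le> c * t" using c that X by (intro mult_right_mono) auto
      then show ?thesis using that by linarith
    qed
    have pw: "\<bar>h\<bar> powr p \<le> (2 * C) powr (p - 1) * \<bar>h\<bar>" if "\<bar>h\<bar> \<le> 2 * C" for h :: real
    proof (cases "h = 0")
      case False
      then have "\<bar>h\<bar> powr p = \<bar>h\<bar> powr (p - 1) * \<bar>h\<bar>"
        by (simp add: powr_diff)
      also have "\<dots> \<le> (2 * C) powr (p - 1) * \<bar>h\<bar>"
        using that p by (intro mult_right_mono powr_mono2) auto
      finally show ?thesis .
    qed (use p in simp)
    have "(\<integral>\<^sup>+t. ennreal (\<bar>\<theta> (c * (t + L)) - \<theta> (c * t)\<bar> powr p) \<partial>lborel)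
        \<le> (\<integral>\<^sup>+t. ennreal ((2 * C) powr (p - 1)) * ennreal \<bar>\<theta> (c * (t + L)) - \<theta> (c * t)\<bar> \<partial>lborel)"
    proof (rule nn_integral_mono)
      fix t
      have "\<bar>\<theta> (c * (t + L)) - \<theta> (c * t)\<bar> \<le> 2 * C"
        using C(2)[of "c * (t + L)"] C(2)[of "c * t"] by linarith
      then show "ennreal (\<bar>\<theta> (c * (t + L)) - \<theta> (c * t)\<bar> powr p)
          \<le> ennreal ((2 * C) powr (p - 1)) * ennreal \<bar>\<theta> (c * (t + L)) - \<theta> (c * t)\<bar>"
        by (simp add: pw ennreal_leI flip: ennreal_mult)
    qed
    also have "\<dots> = ennreal ((2 * C) powr (p - 1)) * (\<integral>\<^sup>+t. ennreal \<bar>\<theta> (c * (t + L)) - \<theta> (c * t)\<bar> \<partial>lborel)"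
      by (rule nn_integral_cmult) measurable
    also have "\<dots> \<le> ennreal ((2 * C) powr (p - 1)) * (4 * J k)"
      unfolding J_def c_def[symmetric]
    proof (intro mult_left_mono nn_integral_increment_le[where \<theta> = "\<lambda>t. \<theta> (c * t)"])
      show "\<bar>\<theta> (c * t)\<bar> \<le> C" for t by (rule C(2))
      have ae: "AE t in lborel. 0 + c * t \<notin> Z" "AE t in lborel. c * L + c * t \<notin> Z"
          "AE t in lborel. 0 + (- c) * t \<notin> Z" "AE t in lborel. - c * L + (- c) * t \<notin> Z"
        using c by (intro AE_affine_notin_null[OF Z]; linarith)+
      show "AE t in lborel. X < t \<longrightarrow> \<bar>\<theta> (c * (t + L)) - \<theta> (c * t)\<bar> + \<bar>\<theta> (c * (t + L))\<bar> = \<bar>\<theta> (c * t)\<bar>"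
        using ae(1,2)
      proof eventually_elim
        case (elim t)
        then show ?case
          using right[of "c * t" "c * (t + L)"] cX[of t] c L by (auto simp: algebra_simps)
      qed
      show "AE t in lborel. X < t \<longrightarrow> \<bar>\<theta> (c * (- (t + L))) - \<theta> (c * (- t))\<bar> + \<bar>\<theta> (c * (- (t + L)))\<bar> = \<bar>\<theta> (c * (- t))\<bar>"
        using ae(3,4)
      proof eventually_elim
        case (elim t)
        then show ?case
          using left[of "c * (- t)" "c * (- (t + L))"] cX[of t] c L by (auto simp: algebra_simps)
      qed
    qed (use L X in auto)
    finally show ?thesis by (simp only: c_def)
  qed
  have "(\<lambda>k. ennreal ((2 * C) powr (p - 1)) * (4 * J k)) \<longlonglongrightarrow> ennreal ((2 * C) powr (p - 1)) * (4 * 0)"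
    by (intro ennreal_tendsto_cmult J) auto
  then have lim: "(\<lambda>k. ennreal ((2 * C) powr (p - 1)) * (4 * J k)) \<longlonglongrightarrow> 0" by simp
  show ?thesis
    by (rule tendsto_sandwich[OF _ _ tendsto_const lim]; intro always_eventually allI zero_le est)
qed

text \<open>The approximant is \<phi>(n(s - c)) - \<phi>(n(s - d)) with s = u \<bullet> x. Its step
  part is exactly (a - b) times the interval indicator, so the error is an increment of \<theta> at
  scale n, small for large n.\<close>

lemma interval_approximation:
  fixes u :: "real ^ 'm::finite"
  assumes \<theta>: "\<theta> \<in> borel_measurable borel" and Z: "Z \<in> null_sets lborel" and X: "0 < X"
    and C: "0 \<le> C" "\<And>t. \<bar>\<theta> t\<bar> \<le> C"
    and \<phi>: "\<And>t. t \<notin> Z \<Longrightarrow> \<phi> t = \<theta> t + (if 0 < t then a else b)"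
    and right: "\<And>s t. X < s \<Longrightarrow> s \<le> t \<Longrightarrow> s \<notin> Z \<Longrightarrow> t \<notin> Z \<Longrightarrow> \<bar>\<theta> t - \<theta> s\<bar> + \<bar>\<theta> t\<bar> = \<bar>\<theta> s\<bar>"
    and left: "\<And>s t. s < -X \<Longrightarrow> t \<le> s \<Longrightarrow> s \<notin> Z \<Longrightarrow> t \<notin> Z \<Longrightarrow> \<bar>\<theta> t - \<theta> s\<bar> + \<bar>\<theta> t\<bar> = \<bar>\<theta> s\<bar>"
    and top: "(\<theta> \<longlongrightarrow> 0) (inf at_top (principal (- Z)))"
    and bot: "(\<theta> \<longlongrightarrow> 0) (inf at_bot (principal (- Z)))"
    and p: "1 \<le> p" and u: "u $ i\<^sub>0 = 1" and cd: "c < d" and e: "0 < e"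
  shows "\<exists>r \<in> ridge_sums \<phi> \<inter> Lp p (strip i\<^sub>0).
    (LINT x|lebesgue_on (strip i\<^sub>0). \<bar>(a - b) * indicator {c<..d} (u \<bullet> x) - r x\<bar> powr p) < e"
proof -
  note [measurable] = \<theta>
  define \<Omega> where "\<Omega> = strip i\<^sub>0"
  define I where "I = (\<lambda>t. (a - b) * indicator {c<..d} t :: real)"
  have I_meas: "I \<in> borel_measurable borel"
    unfolding I_def by measurable
  define \<Delta> where "\<Delta> = (\<lambda>k t. \<theta> (real (Suc k) * (t + (d - c))) - \<theta> (real (Suc k) * t))"
  have \<Delta>_meas[measurable]: "\<Delta> k \<in> borel_measurable borel" for k
    unfolding \<Delta>_def by measurable
  have "(\<lambda>k. \<integral>\<^sup>+t. ennreal (\<bar>\<Delta> k t\<bar> powr p) \<partial>lborel) \<longlonglongrightarrow> 0"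
    unfolding \<Delta>_def
    using cd by (intro rescaled_increment_Lp_tendsto_zero[OF \<theta> Z C X _ p right left top bot]) auto
  then have "eventually (\<lambda>k. (\<integral>\<^sup>+t. ennreal (\<bar>\<Delta> k t\<bar> powr p) \<partial>lborel) < ennreal e) sequentially"
    by (rule order_tendstoD(2)) (use e in simp)
  then obtain k where k: "(\<integral>\<^sup>+t. ennreal (\<bar>\<Delta> k t\<bar> powr p) \<partial>lborel) < ennreal e"
    by (auto simp: eventually_sequentially)
  define n where "n = real (Suc k)"
  have n: "0 < n" by (simp add: n_def)
  \<comment> \<open>Translation by d places the increment over length d - c between t - d and t -
    c.\<close>
  define h where "h = (\<lambda>t. \<Delta> k (t - d))"
  have h_meas[measurable]: "h \<in> borel_measurable borel"
    unfolding h_def by measurable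
  have h_eq: "h t = \<theta> (n * t + - (n * c)) - \<theta> (n * t + - (n * d))" for t
    by (simp add: h_def \<Delta>_def n_def algebra_simps)
  have "(\<integral>\<^sup>+t. ennreal (\<bar>h t\<bar> powr p) \<partial>lborel) = (\<integral>\<^sup>+t. ennreal (\<bar>\<Delta> k t\<bar> powr p) \<partial>lborel)"
    using nn_integral_shift[of "\<lambda>t. ennreal (\<bar>\<Delta> k t\<bar> powr p)" "- d"] by (simp add: h_def)
  then have h_less: "(\<integral>\<^sup>+t. ennreal (\<bar>h t\<bar> powr p) \<partial>lborel) < ennreal e"
    using k by simp
  have h_int: "integrable lborel (\<lambda>t. \<bar>h t\<bar> powr p)"
    using less_trans[OF h_less ennreal_less_top] by (intro integrableI_nonneg) auto
  have h_bound: "(LINT t|lborel. \<bar>h t\<bar> powr p) < e"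
    using h_less nn_integral_eq_integral[OF h_int] e by (simp add: ennreal_less_iff integral_nonneg_AE)
  define r where "r = (\<lambda>x. \<phi> ((n *\<^sub>R u) \<bullet> x + - (n * c)) + (- 1) * \<phi> ((n *\<^sub>R u) \<bullet> x + - (n * d)))"
  have r: "r \<in> ridge_sums \<phi>"
    unfolding r_def by (intro ridge_sums_add ridge_sums_cmult ridge_sums_single)
  have "AE t in lborel. - (n * c) + n * t \<notin> Z" "AE t in lborel. - (n * d) + n * t \<notin> Z"
    using n by (intro AE_affine_notin_null[OF Z]; simp)+
  then have "AE t in lborel. \<phi> (n * t + - (n * c)) - \<phi> (n * t + - (n * d)) = I t + h t"
  proof eventually_elim
    case (elim t)
    have "0 < n * t + - (n * c) \<longleftrightarrow> c < t" "0 < n * t + - (n * d) \<longleftrightarrow> d < t"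
      using n by (simp_all add: mult_less_cancel_left_pos)
    then show ?case
      using elim cd \<phi>[of "n * t + - (n * c)"] \<phi>[of "n * t + - (n * d)"]
      by (simp add: h_eq I_def indicator_def add.commute[of "n * t"])
  qed
  from strip_AE_inner[OF u this]
  have r_eq: "AE x in lebesgue_on \<Omega>. I (u \<bullet> x) + h (u \<bullet> x) = r x"
    unfolding \<Omega>_def by eventually_elim (simp add: r_def)
  \<comment> \<open>Completeness yields measurability of \<open>r\<close> from its almost-everywhere
    equality with a Borel function of u \<bullet> x.\<close>
  interpret \<Omega>: complete_measure "lebesgue_on \<Omega>"
    unfolding \<Omega>_def using sets_strip[of i\<^sub>0] by (intro complete_measure_lebesgue_on) auto
  have IM: "(\<lambda>x. I (u \<bullet> x)) \<in> borel_measurable (lebesgue_on \<Omega>)"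
    and hM: "(\<lambda>x. h (u \<bullet> x)) \<in> borel_measurable (lebesgue_on \<Omega>)"
    unfolding \<Omega>_def by (intro strip_measurable_inner I_meas h_meas)+
  have IL: "(\<lambda>x. I (u \<bullet> x)) \<in> Lp p \<Omega>"
  proof (rule Lp_bounded[OF _ _ IM])
    show "(\<lambda>x. (a - b) * indicator {c..d} (u \<bullet> x)) \<in> Lp p \<Omega>"
      unfolding \<Omega>_def using p by (intro strip_slab_Lp u) simp
  qed (use p in \<open>auto simp: I_def indicator_def\<close>)
  have hL: "(\<lambda>x. h (u \<bullet> x)) \<in> Lp p \<Omega>"
    using hM h_int strip_integrable_inner[OF u, of "\<lambda>t. \<bar>h t\<bar> powr p"] by (simp add: Lp_def \<Omega>_def)
  have rM: "r \<in> borel_measurable (lebesgue_on \<Omega>)"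
    using IM hM by (intro \<Omega>.borel_measurable_AE[OF _ r_eq]) (rule borel_measurable_add)
  have "r \<in> Lp p \<Omega>"
    using p by (intro Lp_bounded[OF _ Lp_add[OF _ IL hL] rM]) (use r_eq in auto)
  moreover have "(LINT x|lebesgue_on \<Omega>. \<bar>I (u \<bullet> x) - r x\<bar> powr p) = (LINT x|lebesgue_on \<Omega>. \<bar>h (u \<bullet> x)\<bar> powr p)"
  proof (rule integral_cong_AE)
    show "AE x in lebesgue_on \<Omega>. \<bar>I (u \<bullet> x) - r x\<bar> powr p = \<bar>h (u \<bullet> x)\<bar> powr p"
      using r_eq
    proof eventually_elim
      case (elim x)
      then have "I (u \<bullet> x) - r x = - h (u \<bullet> x)" by simp
      then show ?case by simp
    qed
  qed (use IM hM rM in measurable)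
  moreover have "\<dots> = (LINT t|lborel. \<bar>h t\<bar> powr p)"
    unfolding \<Omega>_def by (rule strip_integral_inner[OF u]) measurable
  ultimately show ?thesis
    using r h_bound by (intro bexI[of _ r]) (simp_all add: I_def \<Omega>_def)
qed

theorem theorem3p5:
  fixes n :: nat and i\<^sub>0 :: "'m::finite" and \<phi> :: "real \<Rightarrow> real" and a b p :: real
  assumes "CARD('m) = n + 1"
    and "\<phi> \<in> borel_measurable lebesgue"
    and "essentially bounded_fun UNIV \<phi>"
    and "eventually_essentially monotone_fun \<phi>"
    and "ae_tendsto \<phi> a at_top"
    and "ae_tendsto \<phi> b at_bot"
    and "a \<noteq> b"
    and "2 \<le> p"
  shows "Lp_topology p (strip i\<^sub>0) closure_of (ridge_sums \<phi> \<inter> Lp p (strip i\<^sub>0))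
         = Lp p (strip i\<^sub>0)"
proof -
  define \<Omega> where "\<Omega> = strip i\<^sub>0"
  define W where "W = ridge_sums \<phi> \<inter> Lp p \<Omega>"
  obtain \<theta> Z X C where dec: "\<theta> \<in> borel_measurable borel" "Z \<in> null_sets lborel" "0 < X" "0 \<le> C"
    "\<And>t. \<bar>\<theta> t\<bar> \<le> C"
    "\<And>t. t \<notin> Z \<Longrightarrow> \<phi> t = \<theta> t + (if 0 < t then a else b)"
    "\<And>s t. X < s \<Longrightarrow> s \<le> t \<Longrightarrow> s \<notin> Z \<Longrightarrow> t \<notin> Z \<Longrightarrow> \<bar>\<theta> t - \<theta> s\<bar> + \<bar>\<theta> t\<bar> = \<bar>\<theta> s\<bar>"
    "\<And>s t. s < -X \<Longrightarrow> t \<le> s \<Longrightarrow> s \<notin> Z \<Longrightarrow> t \<notin> Z \<Longrightarrow> \<bar>\<theta> t - \<theta> s\<bar> + \<bar>\<theta> t\<bar> = \<bar>\<theta> s\<bar>"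
    "(\<theta> \<longlongrightarrow> 0) (inf at_top (principal (- Z)))" "(\<theta> \<longlongrightarrow> 0) (inf at_bot (principal (- Z)))"
    by (rule sigmoidal_decomposition[OF assms(2-6)]) (rule that)
  interpret Lp_subspace p \<Omega> W
  proof
    show "0 < p" using assms(8) by simp
    show "W \<subseteq> Lp p \<Omega>" by (simp add: W_def)
    show "(\<lambda>x. f x + g x) \<in> W" if "f \<in> W" "g \<in> W" for f g
      using that assms(8) by (auto simp: W_def intro: ridge_sums_add Lp_add)
    show "(\<lambda>x. c * f x) \<in> W" if "f \<in> W" for f c
      using that by (auto simp: W_def intro: ridge_sums_cmult Lp_cmult)
  qed
  \<comment> \<open>The closure \<open>V\<close> here is that of the preceding interpretation. Its
    membership condition for intervals is checked first with the factor a - b, which is then divided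
    out using a \<noteq> b.\<close>
  interpret strip_subspace p i\<^sub>0 W
    rewrites "strip i\<^sub>0 = \<Omega>"
  proof -
    have "(\<lambda>x. indicator {c<..d} (u \<bullet> x)) \<in> V" if cd: "c < d" and u: "u $ i\<^sub>0 = 1" for c d u
    proof -
      have "(\<lambda>x. (a - b) * indicator {c<..d} (u \<bullet> x)) \<in> Lp p \<Omega>"
      proof (rule Lp_bounded)
        show "(\<lambda>x. (a - b) * indicator {c..d} (u \<bullet> x)) \<in> Lp p \<Omega>"
          unfolding \<Omega>_def using p_pos u by (rule strip_slab_Lp)
        show "(\<lambda>x. (a - b) * indicator {c<..d} (u \<bullet> x)) \<in> borel_measurable (lebesgue_on \<Omega>)"
          unfolding \<Omega>_def by (intro strip_measurable_inner) measurable
      qed (use p_pos in \<open>auto simp: indicator_def\<close>)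
      moreover have "\<exists>r\<in>W. (LINT x|lebesgue_on \<Omega>. \<bar>(a - b) * indicator {c<..d} (u \<bullet> x) - r x\<bar> powr p) < e"
        if "0 < e" for e
        unfolding W_def \<Omega>_def
        by (rule interval_approximation[OF dec(1,2,3,4,5,6,7,8,9,10) _ u cd that]) (use assms(8) in auto)
      ultimately have "(\<lambda>x. (a - b) * indicator {c<..d} (u \<bullet> x)) \<in> V"
        unfolding V_def by simp
      from V_cmult[OF this, of "1 / (a - b)"] show ?thesis
        using assms(7) by simp
    qed
    then show "strip_subspace p i\<^sub>0 W"
      unfolding \<Omega>_def using assms(8)
      by (intro strip_subspace.intro strip_subspace_axioms.intro Lp_subspace_axioms[unfolded \<Omega>_def]) auto
  qed (simp add: \<Omega>_def)
  have "f \<in> Lp_topology p \<Omega> closure_of W" if f: "f \<in> Lp p \<Omega>" for f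
    unfolding in_closure_of topspace_Lp_topology
  proof (intro conjI f allI impI)
    fix U assume U: "f \<in> U \<and> openin (Lp_topology p \<Omega>) U"
    then obtain e where e: "0 < e" "\<And>g. g \<in> Lp p \<Omega> \<Longrightarrow> Lp_norm p \<Omega> (\<lambda>x. g x - f x) < e \<Longrightarrow> g \<in> U"
      unfolding openin_Lp_topology by meson
    have "f \<in> V" using f V_eq_Lp by simp
    \<comment> \<open>A tolerance e in \<open>Lp_norm\<close> corresponds to e^p for the integral
      that defines \<open>V\<close>.\<close>
    moreover have "0 < e powr p" using e(1) by simp
    ultimately obtain r where r: "r \<in> W" "(LINT x|lebesgue_on \<Omega>. \<bar>f x - r x\<bar> powr p) < e powr p"
      unfolding V_def by blast
    have "(LINT x|lebesgue_on \<Omega>. \<bar>r x - f x\<bar> powr p) powr (1 / p) < (e powr p) powr (1 / p)"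
      using r(2) p_pos by (intro powr_less_mono2) (auto simp: abs_minus_commute intro: integral_nonneg_AE)
    also have "\<dots> = e"
      using e(1) p_pos by (simp add: powr_powr)
    finally have "Lp_norm p \<Omega> (\<lambda>x. r x - f x) < e"
      by (simp add: Lp_norm_def)
    then have "r \<in> U" using e(2) r(1) W_subset by blast
    then show "\<exists>y. y \<in> W \<and> y \<in> U" using r(1) by blast
  qed
  moreover have "Lp_topology p \<Omega> closure_of W \<subseteq> Lp p \<Omega>"
    using closure_of_subset_topspace[of "Lp_topology p \<Omega>" W] by simp
  ultimately show ?thesis
    unfolding W_def \<Omega>_def by blast
qed

end
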